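(* $\overline{\mathcal{Y}}=\mathcal{Y}\cup\{T_u : u\in\{lm,rm\}^{-\mathbb{N}}\}$.
   Context: Fix finite sets $\pi$ (ports), $\Sigma,\Delta$ (labels), with $m\notin\Sigma$, $m,l,r\notin\pi$. A graph has an at most countable vertex set, edges $\{u:a,v:b\}$ (unordered, $a,b$ ports) with each vertex–port pair in at most one edge, partial vertex and edge labels, and is connected. $\mathcal{X}_{\Sigma,\Delta,\pi}$ is the set of pointed graphs modulo (isomorphism classes of pointed graphs under renamings preserving edges, ports, labels and pointer). In a pointed graph modulo $X$, vertices are designated by paths (words of port pairs $ab$, "leave by $a$, arrive by $b$", from the pointer), identified when reaching the same vertex; $X_u$ is $X$ re-pointed at $u$; the disk $X^r$ is the pointed graph modulo of the subgraph induced by vertices at distance $\le r+1$ from the pointer, with labels kept only on vertices at distance $\le r$ and edges between them. Let $\mathcal{X}'=\mathcal{X}_{\Sigma\cup\{m\},\Delta,\pi\cup\{m,l,r\}}$. $T\in\mathcal{X}'$ is the infinite rooted binary tree pointed at its root, all vertices labelled $m$, each vertex linked through port $l$ (resp. $r$) to port $m$ of its left (resp. right) child. Each $X\in\mathcal{X}_{\Sigma,\Delta,\pi}$ is identified with the element of $\mathcal{X}'$ obtained by attaching to each vertex $v$ a copy of $T$ whose root's port $m$ is linked to port $m$ of $v$; $\mathcal{Y}\subseteq\mathcal{X}'$ is the set of all such graphs pointed at any of their vertices. The closure $\overline{\mathcal{Y}}$ is the set of $Y'\in\mathcal{X}'$ such that for every $r$ there is $Y\in\mathcal{Y}$ with $Y^r=Y'^r$.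 $\{lm,rm\}^{-\mathbb{N}}$ is the set of left-infinite words $u=\cdots a_3a_2a_1$ with $a_i\in\{lm,rm\}$; writing $u_n=a_n\cdots a_1$, $T_u$ denotes the element of $\mathcal{X}'$ whose disk of radius $n$ equals $T_{u_n}^n$ for every $n$ (equivalently, the non-decreasing union of the graphs $T_{u_n}$, $T_{u_n}$ being $T$ re-pointed along $u_n$). *)

theory Defs
  imports Main "HOL-Library.Countable_Set"
begin

section \<open>Port graphs\<close>

text \<open>
  An edge \<open>{u:a, v:b}\<close> is the two-element set \<open>{(u, a), (v, b)}\<close> of vertex-port pairs; the
  case \<open>u = v\<close> (with \<open>a \<noteq> b\<close>) is allowed. Partial labellings are maps whose domain
  consists of vertices (resp. edges) of the graph.
\<close>

type_synonym ('v, 'p) edge = "('v \<times> 'p) set"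

record ('v, 'p, 's, 'd) pgraph =
  verts :: "'v set"
  edges :: "('v, 'p) edge set"
  vlabel :: "'v \<rightharpoonup> 's"
  elabel :: "('v, 'p) edge \<rightharpoonup> 'd"

text \<open>
  \<open>walk G u w v\<close>: the word \<open>w\<close> of port pairs leads from \<open>u\<close> to \<open>v\<close>; the letter \<open>(a, b)\<close>
  means: leave by port \<open>a\<close>, arrive by port \<open>b\<close>.
\<close>

fun walk :: "('v, 'p, 's, 'd) pgraph \<Rightarrow> 'v \<Rightarrow> ('p \<times> 'p) list \<Rightarrow> 'v \<Rightarrow> bool" where
  "walk G u [] v \<longleftrightarrow> u \<in> verts G \<and> u = v"
| "walk G u ((a, b) # w) v \<longleftrightarrow> (\<exists>x. {(u, a), (x, b)} \<in> edges G \<and> walk G x w v)"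

definition port_graph :: "('v, 'p, 's, 'd) pgraph \<Rightarrow> bool" where
  "port_graph G \<longleftrightarrow>
     countable (verts G) \<and>
     (\<forall>e \<in> edges G. card e = 2 \<and> fst ` e \<subseteq> verts G) \<and>
     (\<forall>e \<in> edges G. \<forall>e' \<in> edges G. e \<noteq> e' \<longrightarrow> e \<inter> e' = {}) \<and>
     dom (vlabel G) \<subseteq> verts G \<and>
     dom (elabel G) \<subseteq> edges G \<and>
     (\<forall>u \<in> verts G. \<forall>v \<in> verts G. \<exists>w. walk G u w v)"

definition port_graph_over ::
  "'s set \<Rightarrow> 'd set \<Rightarrow> 'p set \<Rightarrow> ('v, 'p, 's, 'd) pgraph \<Rightarrow> bool" where
  "port_graph_over \<Sigma> \<Delta> \<pi> G \<longleftrightarrow>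
     port_graph G \<and>
     (\<forall>e \<in> edges G. snd ` e \<subseteq> \<pi>) \<and>
     ran (vlabel G) \<subseteq> \<Sigma> \<and>
     ran (elabel G) \<subseteq> \<Delta>"


section \<open>Pointed graphs modulo\<close>

abbreviation rename_edge :: "('v \<Rightarrow> 'w) \<Rightarrow> ('v, 'p) edge \<Rightarrow> ('w, 'p) edge" where
  "rename_edge f e \<equiv> map_prod f id ` e"

definition pointed_iso ::
  "('v \<Rightarrow> 'w) \<Rightarrow> ('v, 'p, 's, 'd) pgraph \<Rightarrow> 'v \<Rightarrow> ('w, 'p, 's, 'd) pgraph \<Rightarrow> 'w \<Rightarrow> bool" where
  "pointed_iso f G p H q \<longleftrightarrow>
     bij_betw f (verts G) (verts H) \<and>
     f p = q \<and>
     edges H = rename_edge f ` edges G \<and>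
     (\<forall>v \<in> verts G. vlabel H (f v) = vlabel G v) \<and>
     (\<forall>e \<in> edges G. elabel H (rename_edge f e) = elabel G e)"

text \<open>
  Vertex sets are at most countable, so every graph has a copy whose vertices are natural
  numbers. The type \<open>nat\<close> serves as the universe of vertex names, and a pointed graph modulo is
  an isomorphism class of pointed graphs over it. \<open>modulo G p\<close> is the class of \<open>(G, p)\<close>, for
  \<open>G\<close> over any vertex type.
\<close>

type_synonym ('p, 's, 'd) graph_modulo = "((nat, 'p, 's, 'd) pgraph \<times> nat) set"

definition modulo :: "('v, 'p, 's, 'd) pgraph \<Rightarrow> 'v \<Rightarrow> ('p, 's, 'd) graph_modulo" where
  "modulo G p = {(H, q). port_graph H \<and> (\<exists>f. pointed_iso f G p H q)}"

definition graphs_modulo ::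
  "'s set \<Rightarrow> 'd set \<Rightarrow> 'p set \<Rightarrow> ('p, 's, 'd) graph_modulo set" where
  "graphs_modulo \<Sigma> \<Delta> \<pi> =
     {modulo G p | (G :: (nat, 'p, 's, 'd) pgraph) p. port_graph_over \<Sigma> \<Delta> \<pi> G \<and> p \<in> verts G}"

text \<open>The operations below are given on representatives and do not depend on their choice.\<close>

definition paths :: "('p, 's, 'd) graph_modulo \<Rightarrow> ('p \<times> 'p) list set" where
  "paths X = {w. \<exists>(G, p) \<in> X. \<exists>v. walk G p w v}"

definition repoint ::
  "('p, 's, 'd) graph_modulo \<Rightarrow> ('p \<times> 'p) list \<Rightarrow> ('p, 's, 'd) graph_modulo" where
  "repoint X w = {(G, v). \<exists>p. (G, p) \<in> X \<and> walk G p w v}"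

definition dball :: "('v, 'p, 's, 'd) pgraph \<Rightarrow> 'v \<Rightarrow> nat \<Rightarrow> 'v set" where
  "dball G p r = {v. \<exists>w. length w \<le> r \<and> walk G p w v}"

definition disk_graph ::
  "('v, 'p, 's, 'd) pgraph \<Rightarrow> 'v \<Rightarrow> nat \<Rightarrow> ('v, 'p, 's, 'd) pgraph" where
  "disk_graph G p r =
     \<lparr>verts = dball G p (r + 1),
      edges = {e \<in> edges G. fst ` e \<subseteq> dball G p (r + 1)},
      vlabel = vlabel G |` dball G p r,
      elabel = elabel G |` {e \<in> edges G. fst ` e \<subseteq> dball G p r}\<rparr>"

definition disk :: "('p, 's, 'd) graph_modulo \<Rightarrow> nat \<Rightarrow> ('p, 's, 'd) graph_modulo" where
  "disk X r = (\<Union>(G, p) \<in> X. modulo (disk_graph G p r) p)"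

definition closure_in ::
  "('p, 's, 'd) graph_modulo set \<Rightarrow> ('p, 's, 'd) graph_modulo set \<Rightarrow>
   ('p, 's, 'd) graph_modulo set" where
  "closure_in \<X> \<Y> = {Y' \<in> \<X>. \<forall>r. \<exists>Y \<in> \<Y>. disk Y r = disk Y' r}"

definition subgraph ::
  "('v, 'p, 's, 'd) pgraph \<Rightarrow> ('v, 'p, 's, 'd) pgraph \<Rightarrow> bool" where
  "subgraph G H \<longleftrightarrow>
     verts G \<subseteq> verts H \<and> edges G \<subseteq> edges H \<and>
     vlabel G \<subseteq>\<^sub>m vlabel H \<and> elabel G \<subseteq>\<^sub>m elabel H"

definition is_union :: "(nat \<Rightarrow> ('v, 'p, 's, 'd) pgraph) \<Rightarrow> ('v, 'p, 's, 'd) pgraph \<Rightarrow> bool" where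
  "is_union G H \<longleftrightarrow>
     verts H = (\<Union>n. verts (G n)) \<and>
     edges H = (\<Union>n. edges (G n)) \<and>
     Map.graph (vlabel H) = (\<Union>n. Map.graph (vlabel (G n))) \<and>
     Map.graph (elabel H) = (\<Union>n. Map.graph (elabel (G n)))"

text \<open>
  The non-decreasing union of pointed graphs modulo \<open>X 0, X 1, \<dots>\<close>: choose representatives with a
  common pointer, each one a subgraph of the next, and take their union. Since a renaming that
  preserves ports and the pointer of a connected graph is unique, all such choices give isomorphic
  pointed graphs.
\<close>

definition nondecreasing_union ::
  "(nat \<Rightarrow> ('p, 's, 'd) graph_modulo) \<Rightarrow> ('p, 's, 'd) graph_modulo" where
  "nondecreasing_union X =
     {(H, p). \<exists>G. (\<forall>n. (G n, p) \<in> X n \<and> subgraph (G n) (G (Suc n))) \<and> is_union G H}"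


section \<open>Attaching infinite binary trees\<close>

text \<open>
  In what follows \<open>mk\<close> is the additional vertex label and \<open>m\<close>, \<open>l\<close>, \<open>r\<close> are the additional ports.
  A vertex of the tree is the word over \<open>{l, r}\<close> describing the descent from the root \<open>[]\<close>.
\<close>

definition tree_graph :: "'s \<Rightarrow> 'p \<Rightarrow> 'p \<Rightarrow> 'p \<Rightarrow> ('p list, 'p, 's, 'd) pgraph" where
  "tree_graph mk m l r =
     \<lparr>verts = lists {l, r},
      edges = {{(x, c), (x @ [c], m)} | x c. x \<in> lists {l, r} \<and> c \<in> {l, r}},
      vlabel = (\<lambda>x. if x \<in> lists {l, r} then Some mk else None),
      elabel = Map.empty\<rparr>"

definition tree :: "'s \<Rightarrow> 'p \<Rightarrow> 'p \<Rightarrow> 'p \<Rightarrow> ('p, 's, 'd) graph_modulo" where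
  "tree mk m l r = modulo (tree_graph mk m l r) []"

text \<open>\<open>Inl v\<close> is the vertex \<open>v\<close> of \<open>G\<close>; \<open>Inr (v, x)\<close> is the vertex \<open>x\<close> of the tree attached to \<open>v\<close>.\<close>

definition attach_trees ::
  "'s \<Rightarrow> 'p \<Rightarrow> 'p \<Rightarrow> 'p \<Rightarrow> ('v, 'p, 's, 'd) pgraph \<Rightarrow> ('v + 'v \<times> 'p list, 'p, 's, 'd) pgraph" where
  "attach_trees mk m l r G =
     (let T = (tree_graph mk m l r :: ('p list, 'p, 's, 'd) pgraph) in
      \<lparr>verts = Inl ` verts G \<union> Inr ` (verts G \<times> verts T),
       edges = rename_edge Inl ` edges G
             \<union> (\<Union>v \<in> verts G. rename_edge (\<lambda>x. Inr (v, x)) ` edges T)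
             \<union> {{(Inl v, m), (Inr (v, []), m)} | v. v \<in> verts G},
       vlabel = case_sum (vlabel G) (\<lambda>(v, x). if v \<in> verts G then vlabel T x else None),
       elabel = (\<lambda>e. elabel G (map_prod Inl id -` e)) |` (rename_edge Inl ` edges G)\<rparr>)"

definition embed ::
  "'s \<Rightarrow> 'p \<Rightarrow> 'p \<Rightarrow> 'p \<Rightarrow> ('p, 's, 'd) graph_modulo \<Rightarrow> ('p, 's, 'd) graph_modulo" where
  "embed mk m l r X = (\<Union>(G, p) \<in> X. modulo (attach_trees mk m l r G) (Inl p))"

definition tree_extended ::
  "'s set \<Rightarrow> 'd set \<Rightarrow> 'p set \<Rightarrow> 's \<Rightarrow> 'p \<Rightarrow> 'p \<Rightarrow> 'p \<Rightarrow> ('p, 's, 'd) graph_modulo set" where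
  "tree_extended \<Sigma> \<Delta> \<pi> mk m l r =
     {repoint (embed mk m l r X) w | X w.
        X \<in> graphs_modulo \<Sigma> \<Delta> \<pi> \<and> w \<in> paths (embed mk m l r X)}"

text \<open>
  A left-infinite word \<open>\<cdots> a\<^sub>3 a\<^sub>2 a\<^sub>1\<close> is the function \<open>u\<close> with \<open>u i = a\<^sub>i\<^sub>+\<^sub>1\<close>, and
  \<open>suffix_word u n\<close> is \<open>a\<^sub>n \<cdots> a\<^sub>1\<close>, read from left to right as a path.
\<close>

definition left_infinite_words :: "'p \<Rightarrow> 'p \<Rightarrow> 'p \<Rightarrow> (nat \<Rightarrow> 'p \<times> 'p) set" where
  "left_infinite_words m l r = {u. \<forall>i. u i \<in> {(l, m), (r, m)}}"

definition suffix_word :: "(nat \<Rightarrow> 'p \<times> 'p) \<Rightarrow> nat \<Rightarrow> ('p \<times> 'p) list" where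
  "suffix_word u n = rev (map u [0..<n])"

text \<open>
  \<open>limit_tree\<close> is \<open>T\<^sub>u\<close>, taken as the non-decreasing union of the re-pointed trees. Describing it
  instead by equality of its disk of radius \<open>n\<close> with that of the \<open>n\<close>-th tree would fail: the
  latter tree's root has distance \<open>n\<close> from the pointer, and the disk of radius \<open>n\<close> in the union
  also contains the (unlabelled) parent of that root, at distance \<open>n + 1\<close>.
\<close>

definition limit_tree ::
  "'s \<Rightarrow> 'p \<Rightarrow> 'p \<Rightarrow> 'p \<Rightarrow> (nat \<Rightarrow> 'p \<times> 'p) \<Rightarrow> ('p, 's, 'd) graph_modulo" where
  "limit_tree mk m l r u =
     nondecreasing_union (\<lambda>n. repoint (tree mk m l r) (suffix_word u n))"

end

theory Submission
  imports Defs
begin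

text \<open>
  The type of a vertex consists of its label and of the labels and ports found across its edges.
  An extended graph has only two kinds of vertices up to type, base and tree vertices, and no
  closed descending walk; a graph in the closure inherits both properties, because each of them is
  visible in a disk. If it has a base vertex, then the part reachable from there through ports in
  \<open>\<pi>\<close> is a graph over the original alphabet, and descending from the \<open>m\<close>-neighbours of its vertices
  fills in the attached trees, so the graph is an extended graph. Otherwise every vertex has a
  parent, the graph is the union of the trees below the ancestors of the pointer, and the turns
  taken on the way up spell the word \<open>u\<close>. Acyclicity is a separate requirement because
  a vertex that is its own left child has a legitimate type. Conversely, \<open>T\<^sub>u\<close> agrees on the disk of
  radius \<open>k\<close> with a tree pointed at depth \<open>k + 2\<close>, where the disk does not reach the root, so it does
  not matter what the root is attached to.
\<close>

section \<open>Walks and embeddings\<close>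

text \<open>A pair of vertex and port lies in at most one edge, so a map that respects ports is
  determined by its value at one vertex of a connected graph. The isomorphisms constructed from
  pieces of \<open>G\<close> are injective maps preserving labels and edges that also miss no edge
  at any image vertex; if nothing is missed on a ball, the same argument gives an isomorphism of
  disks. The closure supplies a new witness for every radius, and these witnesses need not be
  related. This does no harm: each inherited property concerns one vertex with its neighbours, or
  one closed walk, and so needs a single radius that is large enough. Recording neighbour labels in
  the types keeps a descent among tree vertices and forces an edge joining two ports
  \<open>m\<close> to end at a base vertex. Base vertices are unconstrained among themselves. Trees
  hanging from different base vertices stay disjoint because the port \<open>m\<close> of a root
  leads to a port \<open>m\<close>, while that of any other tree vertex leads to \<open>l\<close> or
  \<open>r\<close>.\<close>

text \<open>\<open>port_graph\<close> without connectedness: determinism of ports rests on this part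
  alone, and subgraphs are known to have it before they are known to be connected.\<close>

definition wf_graph :: "('v, 'p, 's, 'd) pgraph \<Rightarrow> bool" where
  "wf_graph G \<longleftrightarrow>
     countable (verts G) \<and>
     (\<forall>e \<in> edges G. card e = 2 \<and> fst ` e \<subseteq> verts G) \<and>
     (\<forall>e \<in> edges G. \<forall>e' \<in> edges G. e \<noteq> e' \<longrightarrow> e \<inter> e' = {}) \<and>
     dom (vlabel G) \<subseteq> verts G \<and>
     dom (elabel G) \<subseteq> edges G"

lemma port_graph_wf: "port_graph G \<Longrightarrow> wf_graph G"
  by (simp add: port_graph_def wf_graph_def)

lemma wf_edgeE:
  assumes "wf_graph G" "e \<in> edges G"
  obtains u a x b where "e = {(u, a), (x, b)}" "(u, a) \<noteq> (x, b)" "u \<in> verts G" "x \<in> verts G"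
proof -
  have "card e = 2" "fst ` e \<subseteq> verts G"
    using assms by (auto simp: wf_graph_def)
  then obtain y z where "e = {y, z}" "y \<noteq> z"
    by (meson card_2_iff)
  then show thesis
    using that[of "fst y" "snd y" "fst z" "snd z"] \<open>fst ` e \<subseteq> verts G\<close> by auto
qed

lemma edge_sub: "wf_graph G \<Longrightarrow> e \<in> edges G \<Longrightarrow> fst ` e \<subseteq> verts G"
  unfolding wf_graph_def by blast

lemma edge_verts:
  assumes "wf_graph G" "{(u, a), (x, b)} \<in> edges G"
  shows "u \<in> verts G" "x \<in> verts G"
proof -
  have "fst ` {(u, a), (x, b)} \<subseteq> verts G"
    using edge_sub[OF assms] .
  then show "u \<in> verts G" "x \<in> verts G" by auto
qed

text \<open>The pair \<open>(u, a)\<close> lies in only one edge. Determinism of walks, uniqueness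
  of renamings and uniqueness of parents all come from here.\<close>

lemma edge_det:
  assumes "wf_graph G" "{(u, a), (x, b)} \<in> edges G" "{(u, a), (y, c)} \<in> edges G"
  shows "x = y \<and> b = c"
proof -
  have "{(u, a), (x, b)} = {(u, a), (y, c)}"
    using assms unfolding wf_graph_def by (meson disjoint_iff insertI1)
  then show ?thesis by (auto simp: doubleton_eq_iff)
qed

lemma walk_start: "wf_graph G \<Longrightarrow> walk G u w v \<Longrightarrow> u \<in> verts G"
  by (cases w) (auto intro: edge_verts(1))

lemma walk_end: "walk G u w v \<Longrightarrow> v \<in> verts G"
  by (induction G u w v rule: walk.induct) auto

lemma walk_append:
  assumes "wf_graph G"
  shows "walk G u (w @ w') v \<longleftrightarrow> (\<exists>x. walk G u w x \<and> walk G x w' v)"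
proof (induction w arbitrary: u)
  case Nil
  then show ?case using walk_start[OF assms] by auto
next
  case (Cons ab w)
  then show ?case by (cases ab) auto
qed

lemma walk_single:
  assumes "wf_graph G"
  shows "walk G u [(a, b)] v \<longleftrightarrow> {(u, a), (v, b)} \<in> edges G"
  using edge_verts(2)[OF assms] by auto

lemma walk_det: "wf_graph G \<Longrightarrow> walk G u w v \<Longrightarrow> walk G u w v' \<Longrightarrow> v = v'"
proof (induction w arbitrary: u)
  case (Cons ab w)
  then show ?case by (cases ab) (auto dest: edge_det)
qed auto

lemma walk_rev: "wf_graph G \<Longrightarrow> walk G u w v \<Longrightarrow> \<exists>w'. length w' = length w \<and> walk G v w' u"
proof (induction w arbitrary: u)
  case Nil
  then show ?case by (auto intro: exI[of _ "[]"])
next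
  case (Cons ab w)
  obtain a b where ab: "ab = (a, b)" by force
  with Cons.prems obtain x where x: "{(u, a), (x, b)} \<in> edges G" "walk G x w v"
    by auto
  from Cons.IH[OF Cons.prems(1) x(2)] obtain w' where w': "length w' = length w" "walk G v w' x"
    by auto
  have "walk G x [(b, a)] u"
    using x(1) walk_single[OF Cons.prems(1)] by (metis insert_commute)
  with w' have "walk G v (w' @ [(b, a)]) u"
    using walk_append[OF Cons.prems(1)] by blast
  then show ?case
    using w'(1) by (intro exI[of _ "w' @ [(b, a)]"]) auto
qed

text \<open>Walks can be reversed, so reachability from the single vertex \<open>p\<close> suffices:
  go back to \<open>p\<close>, then forward.\<close>

lemma port_graphI:
  assumes "wf_graph G" "\<And>v. v \<in> verts G \<Longrightarrow> \<exists>w. walk G p w v"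
  shows "port_graph G"
proof -
  have "\<exists>w. walk G u w v" if "u \<in> verts G" "v \<in> verts G" for u v
    using assms(2)[OF that(1)] assms(2)[OF that(2)] walk_rev[OF assms(1)] walk_append[OF assms(1)]
    by meson
  then show ?thesis
    using assms(1) by (simp add: port_graph_def wf_graph_def)
qed

text \<open>Induction over a connected graph: whatever is passed on along edges reaches every
  vertex. It is applied to images of maps and to sets on which two maps agree.\<close>

lemma connected_closed:
  assumes G: "port_graph G" and p: "p \<in> verts G" "p \<in> W"
    and closed: "\<And>v a x b. v \<in> W \<Longrightarrow> {(v, a), (x, b)} \<in> edges G \<Longrightarrow> x \<in> W"
  shows "verts G \<subseteq> W"
proof
  fix v assume "v \<in> verts G"
  with G p obtain w where "walk G p w v" unfolding port_graph_def by blast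
  then show "v \<in> W" using p(2)
  proof (induction w arbitrary: p)
    case (Cons ab w)
    then show ?case using closed by (cases ab) auto
  qed auto
qed

lemma self_in_dball: "p \<in> verts G \<Longrightarrow> p \<in> dball G p k"
  unfolding dball_def by (auto intro: exI[of _ "[]"])

lemma dball_verts: "dball G p k \<subseteq> verts G"
  unfolding dball_def by (auto dest: walk_end)

lemma dball_mono: "k \<le> k' \<Longrightarrow> dball G p k \<subseteq> dball G p k'"
  unfolding dball_def using le_trans by blast

lemma dball_0: "p \<in> verts G \<Longrightarrow> dball G p 0 = {p}"
  unfolding dball_def by auto

lemma dball_Suc:
  assumes G: "wf_graph G" and p: "p \<in> verts G"
  shows "dball G p (Suc k) = {p} \<union> {x. \<exists>v \<in> dball G p k. \<exists>a b. {(v, a), (x, b)} \<in> edges G}"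
proof (intro equalityI subsetI)
  fix x assume "x \<in> dball G p (Suc k)"
  then obtain w where w: "length w \<le> Suc k" "walk G p w x" by (auto simp: dball_def)
  show "x \<in> {p} \<union> {x. \<exists>v \<in> dball G p k. \<exists>a b. {(v, a), (x, b)} \<in> edges G}"
  proof (cases w rule: rev_cases)
    case Nil
    then show ?thesis using w by auto
  next
    case (snoc w' ab)
    obtain a b where "ab = (a, b)" by force
    with snoc w(2) obtain v where v: "walk G p w' v" "{(v, a), (x, b)} \<in> edges G"
      using walk_append[OF G] walk_single[OF G] by metis
    then have "v \<in> dball G p k" using w(1) snoc by (auto simp: dball_def)
    with v show ?thesis by auto
  qed
next
  fix x assume "x \<in> {p} \<union> {x. \<exists>v \<in> dball G p k. \<exists>a b. {(v, a), (x, b)} \<in> edges G}"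
  then consider "x = p" | v a b where "v \<in> dball G p k" "{(v, a), (x, b)} \<in> edges G" by auto
  then show "x \<in> dball G p (Suc k)"
  proof cases
    case 1
    then show ?thesis using self_in_dball[OF p] by simp
  next
    case 2
    then obtain w where w: "length w \<le> k" "walk G p w v" by (auto simp: dball_def)
    have "walk G v [(a, b)] x" using 2(2) walk_single[OF G] by blast
    with w(2) have "walk G p (w @ [(a, b)]) x" using walk_append[OF G] by blast
    then show ?thesis using w(1) unfolding dball_def by (auto intro!: exI[of _ "w @ [(a, b)]"])
  qed
qed

section \<open>Embeddings and surjectivity at a vertex\<close>

text \<open>The image need not be an induced subgraph: \<open>G\<close> may have further edges at
  image vertices, even between two of them. Labels are compared as options, so what is unlabelled
  has an unlabelled image.\<close>

definition embedding :: "('v \<Rightarrow> 'w) \<Rightarrow> ('v, 'p, 's, 'd) pgraph \<Rightarrow> ('w, 'p, 's, 'd) pgraph \<Rightarrow> bool" where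
  "embedding f K G \<longleftrightarrow>
     inj_on f (verts K) \<and> f ` verts K \<subseteq> verts G \<and>
     (\<forall>v \<in> verts K. vlabel G (f v) = vlabel K v) \<and>
     (\<forall>e \<in> edges K. rename_edge f e \<in> edges G \<and> elabel G (rename_edge f e) = elabel K e)"

text \<open>Local surjectivity, which \<open>embedding\<close> leaves open. It is stated vertex by
  vertex because the copies of the tree have it everywhere except possibly at their roots.\<close>

definition full_at ::
  "('v \<Rightarrow> 'w) \<Rightarrow> ('v, 'p, 's, 'd) pgraph \<Rightarrow> ('w, 'p, 's, 'd) pgraph \<Rightarrow> 'v \<Rightarrow> bool" where
  "full_at f K G v \<longleftrightarrow>
     (\<forall>a x b. {(f v, a), (x, b)} \<in> edges G \<longrightarrow> (\<exists>y. {(v, a), (y, b)} \<in> edges K \<and> x = f y))"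

text \<open>\<open>f\<close> is injective only on vertices, but edges are subsets of
  \<open>verts G \<times> UNIV\<close>, where \<open>map_prod f id\<close> is injective.\<close>

lemma rename_edge_inj_on:
  assumes f: "inj_on f (verts G)" and G: "wf_graph G"
  shows "inj_on (rename_edge f) (edges G)"
proof (rule inj_onI)
  fix e e' assume e: "e \<in> edges G" "e' \<in> edges G" "rename_edge f e = rename_edge f e'"
  have "e \<subseteq> verts G \<times> UNIV" "e' \<subseteq> verts G \<times> UNIV"
    using edge_sub[OF G e(1)] edge_sub[OF G e(2)] by auto
  moreover have "inj_on (map_prod f id) (verts G \<times> UNIV)"
    using f by (auto simp: inj_on_def)
  ultimately show "e = e'" using e(3) inj_on_image_eq_iff[of "map_prod f id" "verts G \<times> UNIV" e e'] by simp
qed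

lemma embedding_edge:
  "embedding f K G \<Longrightarrow> {(u, a), (x, b)} \<in> edges K \<Longrightarrow> {(f u, a), (f x, b)} \<in> edges G"
  unfolding embedding_def by fastforce

lemma embedding_walk: "embedding f K G \<Longrightarrow> walk K u w v \<Longrightarrow> walk G (f u) w (f v)"
proof (induction w arbitrary: u)
  case (Cons ab w)
  then show ?case using embedding_edge by (cases ab) fastforce
qed (auto simp: embedding_def)

lemma pointed_iso_embedding: "pointed_iso f G p H q \<Longrightarrow> embedding f G H"
  unfolding pointed_iso_def embedding_def bij_betw_def by auto

lemma pointed_iso_full:
  assumes f: "pointed_iso f G p H q" and G: "wf_graph G" and v: "v \<in> verts G"
  shows "full_at f G H v"
  unfolding full_at_def
proof (intro allI impI)
  fix a x b assume "{(f v, a), (x, b)} \<in> edges H"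
  then obtain e where e: "e \<in> edges G" "{(f v, a), (x, b)} = rename_edge f e"
    using f by (auto simp: pointed_iso_def)
  obtain u c y d where ed: "e = {(u, c), (y, d)}" "u \<in> verts G" "y \<in> verts G"
    using wf_edgeE[OF G e(1)] by metis
  have "inj_on f (verts G)" using f by (simp add: pointed_iso_def bij_betw_def)
  with e(2) ed v have "(v = u \<and> a = c \<and> x = f y \<and> b = d) \<or> (v = y \<and> a = d \<and> x = f u \<and> b = c)"
    by (auto simp: doubleton_eq_iff dest: inj_onD)
  then show "\<exists>y. {(v, a), (y, b)} \<in> edges G \<and> x = f y"
    using e(1) ed(1) by (auto simp: insert_commute)
qed

text \<open>By fullness the image is closed under the edges of \<open>G\<close>, so connectedness
  makes it all of \<open>G\<close>; fullness then also lifts every edge.\<close>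

lemma iso_of_full:
  assumes K: "wf_graph K" and G: "port_graph G" and f: "embedding f K G" and p: "p \<in> verts K"
    and full: "\<And>v. v \<in> verts K \<Longrightarrow> full_at f K G v"
  shows "pointed_iso f K p G (f p)"
proof -
  have wG: "wf_graph G" by (rule port_graph_wf[OF G])
  have "verts G \<subseteq> f ` verts K"
  proof (rule connected_closed[OF G])
    show "f p \<in> verts G" "f p \<in> f ` verts K" using f p by (auto simp: embedding_def)
    fix v a x b assume "v \<in> f ` verts K" "{(v, a), (x, b)} \<in> edges G"
    then show "x \<in> f ` verts K"
      using full edge_verts(2)[OF K] unfolding full_at_def by blast
  qed
  then have bij: "bij_betw f (verts K) (verts G)"
    using f by (auto simp: embedding_def bij_betw_def)
  have "edges G \<subseteq> rename_edge f ` edges K"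
  proof
    fix e assume e: "e \<in> edges G"
    obtain u a x b where ed: "e = {(u, a), (x, b)}" "u \<in> verts G" using wf_edgeE[OF wG e] by metis
    then obtain v where v: "v \<in> verts K" "u = f v" using bij by (auto simp: bij_betw_def)
    with full e ed obtain y where y: "{(v, a), (y, b)} \<in> edges K" "x = f y"
      unfolding full_at_def by metis
    then have "e = rename_edge f {(v, a), (y, b)}" using ed v by auto
    then show "e \<in> rename_edge f ` edges K" using y(1) by blast
  qed
  then have "edges G = rename_edge f ` edges K"
    using f by (auto simp: embedding_def)
  then show ?thesis
    using bij f by (simp add: pointed_iso_def embedding_def)
qed

section \<open>Balls and disks of graphs\<close>

lemma disk_graph_simps [simp]:
  "verts (disk_graph G p r) = dball G p (r + 1)"
  "edges (disk_graph G p r) = {e \<in> edges G. fst ` e \<subseteq> dball G p (r + 1)}"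
  "vlabel (disk_graph G p r) = vlabel G |` dball G p r"
  "elabel (disk_graph G p r) = elabel G |` {e \<in> edges G. fst ` e \<subseteq> dball G p r}"
  by (simp_all add: disk_graph_def)

text \<open>Vertices at distance \<open>j + 1\<close> are found through edges at distance
  \<open>j\<close>, so fullness up to distance \<open>k\<close> controls balls up to radius
  \<open>k + 1\<close>.\<close>

lemma dball_full:
  assumes K: "wf_graph K" and G: "wf_graph G" and f: "embedding f K G" and p: "p \<in> verts K"
    and full: "\<And>v. v \<in> dball K p k \<Longrightarrow> full_at f K G v"
    and "j \<le> Suc k"
  shows "dball G (f p) j = f ` dball K p j"
  using \<open>j \<le> Suc k\<close>
proof (induction j)
  case 0
  have "f p \<in> verts G" using f p by (auto simp: embedding_def)
  then show ?case by (simp add: dball_0 p)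
next
  case (Suc j)
  have fp: "f p \<in> verts G" using f p by (auto simp: embedding_def)
  have sub: "dball K p j \<subseteq> dball K p k" by (rule dball_mono) (use Suc.prems in auto)
  have IH: "dball G (f p) j = f ` dball K p j" using Suc by auto
  have "(\<exists>v \<in> f ` dball K p j. \<exists>a b. {(v, a), (x, b)} \<in> edges G) \<longleftrightarrow>
      (\<exists>y. x = f y \<and> (\<exists>v \<in> dball K p j. \<exists>a b. {(v, a), (y, b)} \<in> edges K))" for x
    using sub full embedding_edge[OF f] unfolding full_at_def by blast
  then show ?case
    unfolding dball_Suc[OF G fp] dball_Suc[OF K p] IH image_Un by blast
qed

text \<open>Fullness is required up to distance \<open>r + 1\<close>, boundary included, because the
  disk keeps the edges that join two boundary vertices.\<close>

lemma disk_full: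
  assumes K: "wf_graph K" and G: "wf_graph G" and f: "embedding f K G" and p: "p \<in> verts K"
    and full: "\<And>v. v \<in> dball K p (r + 1) \<Longrightarrow> full_at f K G v"
  shows "pointed_iso f (disk_graph K p r) p (disk_graph G (f p) r) (f p)"
proof -
  have ball: "dball G (f p) j = f ` dball K p j" if "j \<le> r + 1" for j
    using dball_full[OF K G f p full] that by auto
  have inj: "inj_on f (verts K)" using f by (simp add: embedding_def)
  have sub: "dball K p j \<subseteq> verts K" for j by (rule dball_verts)
  have mem: "f v \<in> f ` dball K p j \<longleftrightarrow> v \<in> dball K p j" if "v \<in> verts K" for v j
    using inj_on_image_mem_iff[OF inj that sub] .
  have mem_e: "fst ` rename_edge f e \<subseteq> f ` dball K p j \<longleftrightarrow> fst ` e \<subseteq> dball K p j"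
    if "e \<in> edges K" for e j
  proof -
    obtain u a x b where "e = {(u, a), (x, b)}" "u \<in> verts K" "x \<in> verts K"
      using wf_edgeE[OF K \<open>e \<in> edges K\<close>] by metis
    then show ?thesis using mem by simp
  qed
  have fe: "rename_edge f e \<in> edges G" if "e \<in> edges K" for e
    using f that by (simp add: embedding_def)
  have "e \<in> rename_edge f ` {e \<in> edges K. fst ` e \<subseteq> dball K p (r + 1)}"
    if e: "e \<in> edges G" "fst ` e \<subseteq> f ` dball K p (r + 1)" for e
  proof -
    obtain u a x b where ed: "e = {(u, a), (x, b)}" using wf_edgeE[OF G e(1)] by metis
    then obtain v where v: "v \<in> dball K p (r + 1)" "u = f v" using e(2) by auto
    with full e ed obtain y where y: "{(v, a), (y, b)} \<in> edges K" "x = f y"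
      unfolding full_at_def by metis
    then have "e = rename_edge f {(v, a), (y, b)}" using ed v by auto
    moreover have "fst ` {(v, a), (y, b)} \<subseteq> dball K p (r + 1)"
      using mem_e[OF y(1)] e(2) \<open>e = rename_edge f {(v, a), (y, b)}\<close> by blast
    ultimately show ?thesis using y(1) by blast
  qed
  then have "edges (disk_graph G (f p) r) = rename_edge f ` edges (disk_graph K p r)"
    using ball[of "r + 1"] mem_e fe by auto
  moreover have "bij_betw f (verts (disk_graph K p r)) (verts (disk_graph G (f p) r))"
    using ball[of "r + 1"] inj_on_subset[OF inj sub] by (simp add: bij_betw_def)
  moreover have "vlabel (disk_graph G (f p) r) (f v) = vlabel (disk_graph K p r) v"
    if "v \<in> verts (disk_graph K p r)" for v
  proof -
    have "v \<in> verts K" using that sub by auto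
    then show ?thesis using f mem ball[of r] by (simp add: restrict_map_def embedding_def)
  qed
  moreover have "elabel (disk_graph G (f p) r) (rename_edge f e) = elabel (disk_graph K p r) e"
    if "e \<in> edges (disk_graph K p r)" for e
  proof -
    have e: "e \<in> edges K" using that by auto
    then show ?thesis using f mem_e[OF e] fe[OF e] ball[of r]
      by (simp add: restrict_map_def embedding_def)
  qed
  ultimately show ?thesis by (simp add: pointed_iso_def)
qed

lemma wf_subgraph:
  assumes "wf_graph G" "verts K \<subseteq> verts G" "edges K \<subseteq> edges G"
    "\<And>e. e \<in> edges K \<Longrightarrow> fst ` e \<subseteq> verts K"
    "dom (vlabel K) \<subseteq> verts K" "dom (elabel K) \<subseteq> edges K"
  shows "wf_graph K"
proof -
  have "countable (verts K)" using assms(1,2) countable_subset by (auto simp: wf_graph_def)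
  then show ?thesis using assms unfolding wf_graph_def by (meson subsetD)
qed

lemma disk_graph_wf:
  assumes "wf_graph G"
  shows "wf_graph (disk_graph G p r)"
proof (rule wf_subgraph[OF assms])
  have "dball G p r \<subseteq> dball G p (r + 1)" by (simp add: dball_mono)
  then show "dom (vlabel (disk_graph G p r)) \<subseteq> verts (disk_graph G p r)"
    "dom (elabel (disk_graph G p r)) \<subseteq> edges (disk_graph G p r)" by auto
qed (use dball_verts[of G p "r + 1"] in auto)

text \<open>After \<open>i\<close> letters the walk is within distance \<open>k + i\<close>, and the
  disk contains all vertices up to distance \<open>r + 1\<close>.\<close>

lemma walk_in_disk:
  assumes G: "wf_graph G"
  shows "v \<in> dball G p k \<Longrightarrow> k + length w \<le> r + 1 \<Longrightarrow> walk G v w x \<Longrightarrow> walk (disk_graph G p r) v w x"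
proof (induction w arbitrary: v k)
  case Nil
  then show ?case using dball_mono[of k "r + 1" G p] by auto
next
  case (Cons ab w)
  obtain a b where ab: "ab = (a, b)" by force
  with Cons.prems obtain y where y: "{(v, a), (y, b)} \<in> edges G" "walk G y w x" by auto
  obtain w0 where w0: "length w0 \<le> k" "walk G p w0 v" using Cons.prems by (auto simp: dball_def)
  then have "p \<in> verts G" using walk_start[OF G] by blast
  then have yk: "y \<in> dball G p (Suc k)" using y(1) Cons.prems(1) dball_Suc[OF G] by blast
  then have "walk (disk_graph G p r) y w x" using Cons.IH[OF yk] Cons.prems y(2) by auto
  moreover have "v \<in> dball G p (r + 1)" "y \<in> dball G p (r + 1)"
    using dball_mono[of k "r + 1" G p] dball_mono[of "Suc k" "r + 1" G p] yk Cons.prems by auto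
  ultimately show ?case using y(1) ab by auto
qed

lemma walk_of_disk: "walk (disk_graph G p r) v w x \<Longrightarrow> walk G v w x"
proof (induction w arbitrary: v)
  case Nil
  then show ?case using dball_verts[of G p "r + 1"] by auto
next
  case (Cons ab w)
  then show ?case by (cases ab) auto
qed

lemma disk_graph_port_graph:
  assumes G: "wf_graph G" and p: "p \<in> verts G"
  shows "port_graph (disk_graph G p r)"
proof (rule port_graphI[OF disk_graph_wf[OF G], of _ _ p])
  fix v assume "v \<in> verts (disk_graph G p r)"
  then obtain w where "length w \<le> r + 1" "walk G p w v" by (auto simp: dball_def)
  then show "\<exists>w. walk (disk_graph G p r) p w v"
    using walk_in_disk[OF G self_in_dball[OF p], of 0 w r] by auto
qed

section \<open>Isomorphism classes\<close>

text \<open>Outside the image the labels are \<open>None\<close>: \<open>pointed_iso\<close> says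
  nothing there, whereas \<open>port_graph\<close> demands that labels sit on vertices and
  edges.\<close>

definition rename_graph :: "('v \<Rightarrow> 'w) \<Rightarrow> ('v, 'p, 's, 'd) pgraph \<Rightarrow> ('w, 'p, 's, 'd) pgraph" where
  "rename_graph f G =
     \<lparr>verts = f ` verts G,
      edges = rename_edge f ` edges G,
      vlabel = (\<lambda>v. if v \<in> f ` verts G then vlabel G (inv_into (verts G) f v) else None),
      elabel = (\<lambda>e. if e \<in> rename_edge f ` edges G
                     then elabel G (inv_into (edges G) (rename_edge f) e) else None)\<rparr>"

lemma rename_graph_iso:
  assumes "wf_graph G" "inj_on f (verts G)"
  shows "pointed_iso f G p (rename_graph f G) (f p)"
  using assms rename_edge_inj_on[OF assms(2,1)]
  by (simp add: pointed_iso_def rename_graph_def bij_betw_def)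

lemma pointed_iso_port_graph:
  assumes f: "pointed_iso f G p H q" and G: "port_graph G" and p: "p \<in> verts G"
    and dom: "dom (vlabel H) \<subseteq> verts H" "dom (elabel H) \<subseteq> edges H"
  shows "port_graph H"
proof (rule port_graphI)
  have wf: "wf_graph G" by (rule port_graph_wf[OF G])
  have bij: "inj_on f (verts G)" "verts H = f ` verts G" and E: "edges H = rename_edge f ` edges G"
    using f by (auto simp: pointed_iso_def bij_betw_def)
  have injp: "inj_on (map_prod f id) (verts G \<times> UNIV)"
    using bij(1) by (auto simp: inj_on_def)
  have sub: "e \<subseteq> verts G \<times> UNIV" if "e \<in> edges G" for e
    using edge_sub[OF wf that] by auto
  have "card (rename_edge f e) = 2 \<and> fst ` rename_edge f e \<subseteq> verts H" if "e \<in> edges G" for e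
  proof -
    have "card (rename_edge f e) = card e"
      using inj_on_subset[OF injp sub[OF that]] by (rule card_image)
    moreover have "card e = 2" using wf that by (simp add: wf_graph_def)
    moreover have "fst ` rename_edge f e \<subseteq> f ` verts G" using sub[OF that] by auto
    ultimately show ?thesis using bij(2) by simp
  qed
  moreover have "rename_edge f e \<inter> rename_edge f e' = {}"
    if "e \<in> edges G" "e' \<in> edges G" "rename_edge f e \<noteq> rename_edge f e'" for e e'
  proof -
    have "e \<inter> e' = {}" using wf that unfolding wf_graph_def by metis
    then show ?thesis
      using inj_on_image_Int[OF injp sub[OF that(1)] sub[OF that(2)]] by simp
  qed
  moreover have "countable (verts H)" using wf bij(2) by (simp add: wf_graph_def)
  ultimately show "wf_graph H" using dom E by (simp add: wf_graph_def)
  fix v assume "v \<in> verts H"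
  then obtain u where u: "u \<in> verts G" "v = f u" using bij by auto
  then obtain w where "walk G p w u" using G p unfolding port_graph_def by blast
  then show "\<exists>w. walk H (f p) w v"
    using embedding_walk[OF pointed_iso_embedding[OF f]] u by blast
qed

lemma rename_graph_port_graph:
  assumes "port_graph G" "inj_on f (verts G)" "p \<in> verts G"
  shows "port_graph (rename_graph f G)"
proof (rule pointed_iso_port_graph)
  show "pointed_iso f G p (rename_graph f G) (f p)"
    using rename_graph_iso[OF port_graph_wf] assms by metis
qed (use assms in \<open>auto simp: rename_graph_def split: if_splits\<close>)

lemma pointed_iso_trans:
  fixes G :: "('v, 'p, 's, 'd) pgraph"
  assumes f: "pointed_iso f G p H q" and g: "pointed_iso g H q K s"
  shows "pointed_iso (g \<circ> f) G p K s"
proof -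
  have *: "rename_edge (g \<circ> f) e = rename_edge g (rename_edge f e)" for e :: "('v, 'p) edge"
    by (simp add: image_comp map_prod_compose[symmetric])
  have "edges K = rename_edge (g \<circ> f) ` edges G"
    using f g by (simp add: pointed_iso_def image_image[of "rename_edge g" "rename_edge f"] *)
  moreover have "f v \<in> verts H" if "v \<in> verts G" for v
    using f that by (auto simp: pointed_iso_def bij_betw_def)
  moreover have "rename_edge f e \<in> edges H" if "e \<in> edges G" for e
    using f that by (auto simp: pointed_iso_def)
  ultimately show ?thesis
    using f g bij_betw_trans[of f "verts G" "verts H" g "verts K"]
    unfolding pointed_iso_def by (simp add: *)
qed

lemma pointed_iso_inv:
  assumes f: "pointed_iso f G p H q" and G: "wf_graph G" and p: "p \<in> verts G"
  shows "pointed_iso (inv_into (verts G) f) H q G p"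
proof -
  let ?g = "inv_into (verts G) f"
  have bij: "bij_betw f (verts G) (verts H)" and E: "edges H = rename_edge f ` edges G"
    using f by (auto simp: pointed_iso_def)
  have inv: "?g (f v) = v" if "v \<in> verts G" for v
    using bij that by (simp add: bij_betw_def)
  have inv_e: "rename_edge ?g (rename_edge f e) = e" if e: "e \<in> edges G" for e
  proof -
    obtain u a x b where "e = {(u, a), (x, b)}" "u \<in> verts G" "x \<in> verts G"
      using wf_edgeE[OF G e] by metis
    then show ?thesis using inv by simp
  qed
  have "rename_edge ?g ` edges H = edges G"
  proof -
    have "rename_edge ?g ` rename_edge f ` edges G = (\<lambda>e. e) ` edges G"
      unfolding image_image[of "rename_edge ?g" "rename_edge f"]
      using inv_e by (rule image_cong[OF refl])
    then show ?thesis using E by simp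
  qed
  moreover have "?g q = p" using f inv[OF p] by (auto simp: pointed_iso_def)
  moreover have "vlabel G (?g v) = vlabel H v" if v: "v \<in> verts H" for v
  proof -
    obtain u where "u \<in> verts G" "v = f u" using v bij by (auto simp: bij_betw_def)
    then show ?thesis using f inv by (simp add: pointed_iso_def)
  qed
  moreover have "elabel G (rename_edge ?g e) = elabel H e" if e: "e \<in> edges H" for e
  proof -
    obtain d where "d \<in> edges G" "e = rename_edge f d" using e E by auto
    then show ?thesis using f inv_e by (simp add: pointed_iso_def)
  qed
  ultimately show ?thesis
    using bij_betw_inv_into[OF bij] by (simp add: pointed_iso_def)
qed

lemma pointed_iso_pointer: "pointed_iso f G p H q \<Longrightarrow> p \<in> verts G \<Longrightarrow> q \<in> verts H"
  by (auto simp: pointed_iso_def bij_betw_def)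

section \<open>Operations on classes, computed on one representative over any vertex type\<close>

lemma modulo_iff: "(H, q) \<in> modulo G p \<longleftrightarrow> port_graph H \<and> (\<exists>f. pointed_iso f G p H q)"
  by (simp add: modulo_def)

lemma modulo_eqI:
  assumes f: "pointed_iso f G p H q" and G: "wf_graph G" and p: "p \<in> verts G"
  shows "modulo G p = modulo H q"
proof -
  have "(K, s) \<in> modulo G p \<longleftrightarrow> (K, s) \<in> modulo H q" for K s
    unfolding modulo_iff
    using pointed_iso_trans[OF f, of _ K s] pointed_iso_trans[OF pointed_iso_inv[OF f G p], of _ K s]
    by metis
  then show ?thesis by auto
qed

text \<open>Countability of the vertex set provides the numbering; this is what makes the class of a
  graph over another vertex type inhabited.\<close>

lemma nat_representative:
  assumes "port_graph G" "p \<in> verts G"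
  obtains f H where "pointed_iso f G p H (f p)" "port_graph (H :: (nat, 'p, 's, 'd) pgraph)"
proof -
  have "inj_on (to_nat_on (verts G)) (verts G)"
    using assms by (auto simp: port_graph_def)
  then show thesis
    using that[OF rename_graph_iso[OF port_graph_wf[OF assms(1)]] rename_graph_port_graph[OF assms(1) _ assms(2)]]
    by metis
qed

text \<open>Graphs over different vertex types are compared through a common copy over
  \<open>nat\<close>: the isomorphism from \<open>G\<close> onto it is followed by the inverse of
  the one from \<open>H\<close>.\<close>

lemma modulo_eqD:
  assumes eq: "modulo G p = modulo H q"
    and G: "port_graph G" "p \<in> verts G" and H: "wf_graph H" "q \<in> verts H"
  obtains f where "pointed_iso f G p H q"
proof -
  obtain f and K :: "(nat, _, _, _) pgraph" where K: "pointed_iso f G p K (f p)" "port_graph K"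
    using nat_representative[OF G] by blast
  then have "(K, f p) \<in> modulo H q" unfolding eq[symmetric] by (auto simp: modulo_iff)
  then obtain g where "pointed_iso g H q K (f p)" by (auto simp: modulo_iff)
  from that[OF pointed_iso_trans[OF K(1) pointed_iso_inv[OF this H]]] show thesis .
qed

lemma modulo_nonempty:
  assumes "port_graph G" "p \<in> verts G"
  shows "modulo G p \<noteq> {}"
proof -
  obtain f and K :: "(nat, _, _, _) pgraph" where "pointed_iso f G p K (f p)" "port_graph K"
    using nat_representative[OF assms] by blast
  then have "(K, f p) \<in> modulo G p" by (auto simp: modulo_iff)
  then show ?thesis by blast
qed

text \<open>A union over all representatives collapses once its members do not depend on the
  representative; nonemptiness of the class keeps it from being an empty union.\<close>

lemma Union_modulo:
  assumes G: "port_graph G" "p \<in> verts G"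
    and F: "\<And>f H q. pointed_iso f G p H q \<Longrightarrow> port_graph H \<Longrightarrow> F H q = C"
  shows "(\<Union>(H, q) \<in> modulo G p. F H q) = C"
proof -
  have "F H q = C" if "(H, q) \<in> modulo G p" for H q
    using that F by (auto simp: modulo_iff)
  then show ?thesis using modulo_nonempty[OF G] by fastforce
qed

text \<open>An isomorphism is full everywhere, hence restricts to the disks by
  \<open>disk_full\<close>.\<close>

lemma disk_modulo:
  assumes G: "port_graph G" "p \<in> verts G"
  shows "disk (modulo G p) r = modulo (disk_graph G p r) p"
  unfolding disk_def
proof (rule Union_modulo[OF G])
  fix f and H :: "(nat, _, _, _) pgraph" and q
  assume f: "pointed_iso f G p H q" and H: "port_graph H"
  have wG: "wf_graph G" and wH: "wf_graph H" using G H port_graph_wf by auto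
  have "pointed_iso f (disk_graph G p r) p (disk_graph H (f p) r) (f p)"
  proof (rule disk_full[OF wG wH pointed_iso_embedding[OF f] G(2)])
    show "full_at f G H v" if "v \<in> dball G p (r + 1)" for v
      using pointed_iso_full[OF f wG] that dball_verts[of G p "r + 1"] by blast
  qed
  moreover have "f p = q" using f by (simp add: pointed_iso_def)
  moreover have "p \<in> verts (disk_graph G p r)" using self_in_dball[OF G(2)] by simp
  ultimately show "modulo (disk_graph H q r) q = modulo (disk_graph G p r) p"
    using modulo_eqI disk_graph_wf[OF wG] by metis
qed

text \<open>Walks are deterministic, so in every representative the end of \<open>w\<close> must be
  the image of \<open>v\<close>.\<close>

lemma repoint_modulo:
  assumes G: "port_graph G" and w: "walk G p w v"
  shows "repoint (modulo G p) w = modulo G v"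
proof -
  have wG: "wf_graph G" by (rule port_graph_wf[OF G])
  have p: "p \<in> verts G" and v: "v \<in> verts G" using walk_start[OF wG w] walk_end[OF w] by auto
  have "(H, x) \<in> repoint (modulo G p) w \<longleftrightarrow> (H, x) \<in> modulo G v" for H x
  proof
    assume "(H, x) \<in> repoint (modulo G p) w"
    then obtain q f where H: "port_graph H" "pointed_iso f G p H q" "walk H q w x"
      by (auto simp: repoint_def modulo_iff)
    have "f p = q" using H(2) by (simp add: pointed_iso_def)
    then have "walk H q w (f v)" using embedding_walk[OF pointed_iso_embedding[OF H(2)] w] by simp
    then have "x = f v" using walk_det[OF port_graph_wf[OF H(1)] H(3)] by blast
    then have "pointed_iso f G v H x" using H(2) by (simp add: pointed_iso_def)
    then show "(H, x) \<in> modulo G v" using H by (auto simp: modulo_iff)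
  next
    assume "(H, x) \<in> modulo G v"
    then obtain f where H: "port_graph H" "pointed_iso f G v H x" by (auto simp: modulo_iff)
    have "f v = x" using H(2) by (simp add: pointed_iso_def)
    then have "walk H (f p) w x" using embedding_walk[OF pointed_iso_embedding[OF H(2)] w] by simp
    moreover have "pointed_iso f G p H (f p)" using H(2) by (simp add: pointed_iso_def)
    ultimately show "(H, x) \<in> repoint (modulo G p) w"
      using H(1) by (auto simp: repoint_def modulo_iff)
  qed
  then show ?thesis by auto
qed

lemma paths_modulo:
  assumes G: "port_graph G" "p \<in> verts G"
  shows "w \<in> paths (modulo G p) \<longleftrightarrow> (\<exists>v. walk G p w v)"
proof
  assume "w \<in> paths (modulo G p)"
  then obtain f and H :: "(nat, _, _, _) pgraph" and q v
    where H: "pointed_iso f G p H q" "walk H q w v"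
    by (auto simp: paths_def modulo_iff)
  have inv: "pointed_iso (inv_into (verts G) f) H q G p"
    using pointed_iso_inv[OF H(1) port_graph_wf[OF G(1)] G(2)] .
  then have "inv_into (verts G) f q = p" by (simp add: pointed_iso_def)
  then show "\<exists>v. walk G p w v"
    using embedding_walk[OF pointed_iso_embedding[OF inv] H(2)] by auto
next
  assume "\<exists>v. walk G p w v"
  then obtain v where v: "walk G p w v" by blast
  obtain f and K :: "(nat, _, _, _) pgraph" where K: "pointed_iso f G p K (f p)" "port_graph K"
    using nat_representative[OF G] by blast
  then have "walk K (f p) w (f v)"
    using embedding_walk[OF pointed_iso_embedding[OF K(1)] v] by simp
  moreover have "(K, f p) \<in> modulo G p" using K by (auto simp: modulo_iff)
  ultimately show "w \<in> paths (modulo G p)" unfolding paths_def by blast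
qed

lemma port_graph_over_iso:
  fixes G :: "('v, 'p, 's, 'd) pgraph"
  assumes f: "pointed_iso f G p H q" and G: "port_graph_over \<Sigma> \<Delta> \<pi> G" and H: "port_graph H"
  shows "port_graph_over \<Sigma> \<Delta> \<pi> H"
proof -
  have bij: "verts H = f ` verts G" "edges H = rename_edge f ` edges G"
    using f by (auto simp: pointed_iso_def bij_betw_def)
  have "snd ` rename_edge f e = snd ` e" for e :: "('v, 'p) edge" by force
  then have "\<forall>e \<in> edges H. snd ` e \<subseteq> \<pi>"
    using G bij(2) by (auto simp: port_graph_over_def)
  moreover have "ran (vlabel H) \<subseteq> \<Sigma>"
  proof
    fix s assume "s \<in> ran (vlabel H)"
    then obtain x where x: "vlabel H x = Some s" by (auto simp: ran_def)
    then have "x \<in> verts H" using H by (auto simp: port_graph_def)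
    then obtain v where "v \<in> verts G" "x = f v" using bij by auto
    then have "vlabel G v = Some s" using f x by (simp add: pointed_iso_def)
    then show "s \<in> \<Sigma>" using G by (auto simp: port_graph_over_def ran_def)
  qed
  moreover have "ran (elabel H) \<subseteq> \<Delta>"
  proof
    fix s assume "s \<in> ran (elabel H)"
    then obtain x where x: "elabel H x = Some s" by (auto simp: ran_def)
    then have "x \<in> edges H" using H by (auto simp: port_graph_def)
    then obtain e where "e \<in> edges G" "x = rename_edge f e" using bij by auto
    then have "elabel G e = Some s" using f x by (simp add: pointed_iso_def)
    then show "s \<in> \<Delta>" using G by (auto simp: port_graph_over_def ran_def)
  qed
  ultimately show ?thesis using H by (simp add: port_graph_over_def)
qed

lemma modulo_in_graphs_modulo:
  fixes G :: "('v, 'p, 's, 'd) pgraph"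
  assumes G: "port_graph_over \<Sigma> \<Delta> \<pi> G" and p: "p \<in> verts G"
  shows "modulo G p \<in> graphs_modulo \<Sigma> \<Delta> \<pi>"
proof -
  have pG: "port_graph G" using G by (simp add: port_graph_over_def)
  obtain f and K :: "(nat, 'p, 's, 'd) pgraph" where K: "pointed_iso f G p K (f p)" "port_graph K"
    using nat_representative[OF pG p] by blast
  have "modulo G p = modulo K (f p)" using modulo_eqI[OF K(1) port_graph_wf[OF pG] p] .
  then show ?thesis
    using port_graph_over_iso[OF K(1) G K(2)] pointed_iso_pointer[OF K(1) p]
    unfolding graphs_modulo_def by blast
qed


section \<open>Non-decreasing unions\<close>

lemma subgraph_refl: "subgraph G G"
  by (simp add: subgraph_def)

lemma subgraph_trans: "subgraph G H \<Longrightarrow> subgraph H K \<Longrightarrow> subgraph G K"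
  unfolding subgraph_def by (meson map_le_trans subset_trans)

lemma chain_subgraph:
  assumes "\<And>n. subgraph (G n) (G (Suc n))" "k \<le> n"
  shows "subgraph (G k) (G n)"
  using assms(2) by (induction rule: dec_induct) (auto intro: subgraph_refl subgraph_trans assms(1))

lemma subgraph_vlabel: "subgraph G H \<Longrightarrow> vlabel G v = Some s \<Longrightarrow> vlabel H v = Some s"
  by (auto simp: subgraph_def map_le_def dom_def)

lemma subgraph_elabel: "subgraph G H \<Longrightarrow> elabel G e = Some s \<Longrightarrow> elabel H e = Some s"
  by (auto simp: subgraph_def map_le_def dom_def)

lemma subgraph_walk: "subgraph G H \<Longrightarrow> walk G u w v \<Longrightarrow> walk H u w v"
proof (induction w arbitrary: u)
  case (Cons ab w)
  then show ?case by (cases ab) (auto simp: subgraph_def)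
qed (auto simp: subgraph_def)

lemma is_union_vlabel:
  assumes "is_union G H"
  shows "vlabel H v = Some s \<longleftrightarrow> (\<exists>n. vlabel (G n) v = Some s)"
proof -
  have "(v, s) \<in> Map.graph (vlabel H) \<longleftrightarrow> (\<exists>n. (v, s) \<in> Map.graph (vlabel (G n)))"
    using assms by (simp add: is_union_def)
  then show ?thesis by (simp add: Map.graph_def)
qed

lemma is_union_elabel:
  assumes "is_union G H"
  shows "elabel H e = Some s \<longleftrightarrow> (\<exists>n. elabel (G n) e = Some s)"
proof -
  have "(e, s) \<in> Map.graph (elabel H) \<longleftrightarrow> (\<exists>n. (e, s) \<in> Map.graph (elabel (G n)))"
    using assms by (simp add: is_union_def)
  then show ?thesis by (simp add: Map.graph_def)
qed

lemma is_unionI: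
  assumes "verts H = (\<Union>n. verts (G n))" "edges H = (\<Union>n. edges (G n))"
    and "\<And>v s. vlabel H v = Some s \<longleftrightarrow> (\<exists>n. vlabel (G n) v = Some s)"
    and "\<And>e s. elabel H e = Some s \<longleftrightarrow> (\<exists>n. elabel (G n) e = Some s)"
  shows "is_union G H"
  using assms by (auto simp: is_union_def Map.graph_def)

lemma chain_union_subgraph:
  assumes "is_union G H"
  shows "subgraph (G n) H"
proof -
  have "vlabel (G n) \<subseteq>\<^sub>m vlabel H"
    unfolding map_le_def using is_union_vlabel[OF assms] by (metis domD)
  moreover have "elabel (G n) \<subseteq>\<^sub>m elabel H"
    unfolding map_le_def using is_union_elabel[OF assms] by (metis domD)
  ultimately show ?thesis using assms by (auto simp: subgraph_def is_union_def)
qed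

lemma union_port_graph:
  assumes chain: "\<And>n. subgraph (G n) (G (Suc n))" and U: "is_union G H"
    and G: "\<And>n. port_graph (G n)" and p: "\<And>n. p \<in> verts (G n)"
  shows "port_graph H"
proof (rule port_graphI)
  have wf: "wf_graph (G n)" for n using G port_graph_wf by blast
  have V: "verts H = (\<Union>n. verts (G n))" and E: "edges H = (\<Union>n. edges (G n))"
    using U by (auto simp: is_union_def)
  have "countable (verts H)" unfolding V using wf by (auto simp: wf_graph_def)
  moreover have "card e = 2 \<and> fst ` e \<subseteq> verts H" if e: "e \<in> edges H" for e
  proof -
    obtain n where n: "e \<in> edges (G n)" using e E by auto
    then have "card e = 2" using wf by (simp add: wf_graph_def)
    then show ?thesis using edge_sub[OF wf n] V by auto
  qed
  moreover have "e \<inter> e' = {}" if ee: "e \<in> edges H" "e' \<in> edges H" "e \<noteq> e'" for e e'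
  proof -
    obtain i j where "e \<in> edges (G i)" "e' \<in> edges (G j)" using ee E by auto
    moreover have "subgraph (G i) (G (max i j))" "subgraph (G j) (G (max i j))"
      using chain_subgraph[of G, OF chain] by auto
    ultimately have "e \<in> edges (G (max i j))" "e' \<in> edges (G (max i j))"
      by (auto simp: subgraph_def)
    then show ?thesis using wf[of "max i j"] ee(3) unfolding wf_graph_def by blast
  qed
  moreover have "dom (vlabel H) \<subseteq> verts H"
  proof
    fix v assume "v \<in> dom (vlabel H)"
    then obtain n where "v \<in> dom (vlabel (G n))" using is_union_vlabel[OF U] by blast
    then show "v \<in> verts H" using wf[of n] V by (auto simp: wf_graph_def)
  qed
  moreover have "dom (elabel H) \<subseteq> edges H"
  proof
    fix v assume "v \<in> dom (elabel H)"
    then obtain n where "v \<in> dom (elabel (G n))" using is_union_elabel[OF U] by blast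
    then show "v \<in> edges H" using wf[of n] E by (auto simp: wf_graph_def)
  qed
  ultimately show "wf_graph H" unfolding wf_graph_def by blast
  fix v assume "v \<in> verts H"
  then obtain n where "v \<in> verts (G n)" using V by auto
  then obtain w where "walk (G n) p w v" using G[of n] p[of n] unfolding port_graph_def by blast
  then show "\<exists>w. walk H p w v" using subgraph_walk[OF chain_union_subgraph[OF U]] by blast
qed

text \<open>In \<open>G\<close> a start and a departure port determine the end of an edge, so
  agreement of \<open>f\<close> and \<open>g\<close> spreads from \<open>p\<close> along the edges
  of \<open>K\<close>.\<close>

lemma hom_unique:
  assumes K: "port_graph K" and p: "p \<in> verts K" and G: "wf_graph G"
    and f: "\<And>u a x b. {(u, a), (x, b)} \<in> edges K \<Longrightarrow> {(f u, a), (f x, b)} \<in> edges G"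
    and g: "\<And>u a x b. {(u, a), (x, b)} \<in> edges K \<Longrightarrow> {(g u, a), (g x, b)} \<in> edges G"
    and fg: "f p = g p" and v: "v \<in> verts K"
  shows "f v = g v"
proof -
  have "verts K \<subseteq> {v. f v = g v}"
  proof (rule connected_closed[OF K p])
    fix v a x b assume "v \<in> {v. f v = g v}" "{(v, a), (x, b)} \<in> edges K"
    then show "x \<in> {v. f v = g v}" using f[of v a x b] g[of v a x b] edge_det[OF G, of "f v" a] by auto
  qed (use fg in simp)
  then show ?thesis using v by blast
qed

text \<open>The isomorphisms between the members of the two chains are not assumed to be compatible;
  \<open>hom_unique\<close> makes them so, and they glue to one map \<open>h\<close>.\<close>

lemma union_iso:
  assumes G: "\<And>n. subgraph (G n) (G (Suc n))" "is_union G U"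
      "\<And>n. port_graph (G n)" "\<And>n. p \<in> verts (G n)"
    and H: "\<And>n. subgraph (H n) (H (Suc n))" "is_union H V" "\<And>n. port_graph (H n)"
    and f: "\<And>n. pointed_iso (f n) (G n) p (H n) q"
  obtains h where "pointed_iso h U p V q"
proof -
  define N where "N v = (LEAST n. v \<in> verts (G n))" for v
  define h where "h v = f (N v) v" for v
  have chG: "subgraph (G i) (G j)" and chH: "subgraph (H i) (H j)" if "i \<le> j" for i j
    using chain_subgraph[of G, OF G(1) that] chain_subgraph[of H, OF H(1) that] .
  have q: "q \<in> verts (H n)" for n using pointed_iso_pointer[OF f G(4)] .
  have pU: "port_graph U" using union_port_graph[OF G] .
  have pV: "port_graph V" using union_port_graph[OF H q] .
  have emb: "embedding (f n) (G n) (H n)" for n using pointed_iso_embedding[OF f] .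
  have VU: "verts U = (\<Union>n. verts (G n))" "edges U = (\<Union>n. edges (G n))"
    and VV: "verts V = (\<Union>n. verts (H n))" "edges V = (\<Union>n. edges (H n))"
    using G(2) H(2) by (auto simp: is_union_def)
  \<comment> \<open>Both \<open>f i\<close> and \<open>f j\<close> map edges of \<open>G i\<close>
    to edges of \<open>H j\<close>, and both send \<open>p\<close> to \<open>q\<close>.\<close>
  have agree: "f i v = f j v" if "i \<le> j" "v \<in> verts (G i)" for i j v
  proof (rule hom_unique[OF G(3) G(4) port_graph_wf[OF H(3)] _ _ _ that(2)])
    fix u a x b assume e: "{(u, a), (x, b)} \<in> edges (G i)"
    show "{(f i u, a), (f i x, b)} \<in> edges (H j)"
      using embedding_edge[OF emb e] chH[OF that(1)] by (auto simp: subgraph_def)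
    have "{(u, a), (x, b)} \<in> edges (G j)" using e chG[OF that(1)] by (auto simp: subgraph_def)
    then show "{(f j u, a), (f j x, b)} \<in> edges (H j)" using embedding_edge[OF emb] by blast
  next
    show "f i p = f j p" using f by (simp add: pointed_iso_def)
  qed
  have h: "h v = f n v" if "v \<in> verts (G n)" for v n
  proof -
    have "v \<in> verts (G (N v))" "N v \<le> n"
      unfolding N_def using that by (auto intro: LeastI Least_le)
    then show ?thesis using agree by (simp add: h_def)
  qed
  have he: "rename_edge h e = rename_edge (f n) e" if "e \<in> edges (G n)" for e n
  proof -
    obtain u a x b where "e = {(u, a), (x, b)}" "u \<in> verts (G n)" "x \<in> verts (G n)"
      using wf_edgeE[OF port_graph_wf[OF G(3)] \<open>e \<in> edges (G n)\<close>] by metis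
    then show ?thesis using h by simp
  qed
  \<comment> \<open>A vertex or an edge may receive its label later in the chain than it appears, so
    labels are compared at all sufficiently late indices.\<close>
  have up: "\<exists>n\<ge>k. P n" if "\<exists>n. P n" "\<And>i j. i \<le> j \<Longrightarrow> P i \<Longrightarrow> P j" for P and k :: nat
    using that by (metis max.cobounded1 max.cobounded2)
  have labV: "vlabel V (h v) = vlabel U v" if v: "v \<in> verts U" for v
  proof -
    obtain k where k: "v \<in> verts (G k)" using v VU by auto
    have mG: "v \<in> verts (G n)" if "k \<le> n" for n using chG[OF that] k by (auto simp: subgraph_def)
    have fl: "vlabel (H n) (f n v) = vlabel (G n) v" if "k \<le> n" for n
      using mG[OF that] f by (auto simp: pointed_iso_def)
    have "vlabel U v = Some s \<longleftrightarrow> vlabel V (h v) = Some s" for s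
    proof -
      have "vlabel U v = Some s \<longleftrightarrow> (\<exists>n\<ge>k. vlabel (G n) v = Some s)"
        unfolding is_union_vlabel[OF G(2)]
        using up[of "\<lambda>n. vlabel (G n) v = Some s" k] subgraph_vlabel[OF chG] by blast
      also have "\<dots> \<longleftrightarrow> (\<exists>n\<ge>k. vlabel (H n) (h v) = Some s)"
        using fl h mG by metis
      also have "\<dots> \<longleftrightarrow> vlabel V (h v) = Some s"
        unfolding is_union_vlabel[OF H(2)]
        using up[of "\<lambda>n. vlabel (H n) (h v) = Some s" k] subgraph_vlabel[OF chH] by blast
      finally show ?thesis .
    qed
    then show ?thesis by (metis not_Some_eq)
  qed
  have labE: "elabel V (rename_edge h e) = elabel U e" if e: "e \<in> edges U" for e
  proof -
    obtain k where k: "e \<in> edges (G k)" using e VU by auto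
    have mG: "e \<in> edges (G n)" if "k \<le> n" for n using chG[OF that] k by (auto simp: subgraph_def)
    have fl: "elabel (H n) (rename_edge h e) = elabel (G n) e" if "k \<le> n" for n
      using mG[OF that] f[of n] he[OF mG[OF that]] by (auto simp: pointed_iso_def)
    have "elabel U e = Some s \<longleftrightarrow> elabel V (rename_edge h e) = Some s" for s
    proof -
      have "elabel U e = Some s \<longleftrightarrow> (\<exists>n\<ge>k. elabel (G n) e = Some s)"
        unfolding is_union_elabel[OF G(2)]
        using up[of "\<lambda>n. elabel (G n) e = Some s" k] subgraph_elabel[OF chG] by blast
      also have "\<dots> \<longleftrightarrow> (\<exists>n\<ge>k. elabel (H n) (rename_edge h e) = Some s)"
        using fl by metis
      also have "\<dots> \<longleftrightarrow> elabel V (rename_edge h e) = Some s"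
        unfolding is_union_elabel[OF H(2)]
        using up[of "\<lambda>n. elabel (H n) (rename_edge h e) = Some s" k] subgraph_elabel[OF chH]
        by blast
      finally show ?thesis .
    qed
    then show ?thesis by (metis not_Some_eq)
  qed
  have "inj_on h (verts U)"
  proof (rule inj_onI)
    fix v v' assume vv: "v \<in> verts U" "v' \<in> verts U" "h v = h v'"
    then obtain i j where "v \<in> verts (G i)" "v' \<in> verts (G j)" using VU by auto
    then have "v \<in> verts (G (max i j))" "v' \<in> verts (G (max i j))"
      using chG[of i "max i j"] chG[of j "max i j"] by (auto simp: subgraph_def)
    moreover have "inj_on (f (max i j)) (verts (G (max i j)))"
      using emb by (simp add: embedding_def)
    ultimately show "v = v'" using vv(3) h by (simp add: inj_on_eq_iff)
  qed
  moreover have "h ` verts U \<subseteq> verts V"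
    using h emb unfolding VU VV embedding_def by fastforce
  moreover have "rename_edge h e \<in> edges V" if "e \<in> edges U" for e
    using that he emb unfolding VU VV embedding_def by (metis UN_iff)
  ultimately have "embedding h U V" using labV labE by (simp add: embedding_def)
  moreover have "full_at h U V v" if v: "v \<in> verts U" for v
    unfolding full_at_def
  proof (intro allI impI)
    fix a x b assume "{(h v, a), (x, b)} \<in> edges V"
    then obtain i j where ij: "{(h v, a), (x, b)} \<in> edges (H i)" "v \<in> verts (G j)"
      using v VU VV by auto
    define n where "n = max i j"
    have n: "{(h v, a), (x, b)} \<in> edges (H n)" "v \<in> verts (G n)"
      using ij chH[of i n] chG[of j n] by (auto simp: subgraph_def n_def)
    then obtain y where y: "{(v, a), (y, b)} \<in> edges (G n)" "x = f n y"
      using pointed_iso_full[OF f port_graph_wf[OF G(3)] n(2)] h[OF n(2)] unfolding full_at_def by metis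
    then have "y \<in> verts (G n)" using edge_verts(2)[OF port_graph_wf[OF G(3)]] by blast
    then show "\<exists>y. {(v, a), (y, b)} \<in> edges U \<and> x = h y" using y h VU by auto
  qed
  moreover have pv: "p \<in> verts U" using G(4) VU by auto
  ultimately have "pointed_iso h U p V (h p)"
    using iso_of_full[OF port_graph_wf[OF pU] pV] by blast
  moreover have "h p = q" using h[OF G(4)[of 0]] f by (simp add: pointed_iso_def)
  ultimately show thesis using that by blast
qed

text \<open>One inclusion glues the isomorphisms between two chains. For the other, a copy of
  \<open>U\<close> contains a copy of the chain, obtained by renaming every \<open>K n\<close> with
  the same map.\<close>

lemma nondecreasing_union_modulo:
  assumes K: "\<And>n. subgraph (K n) (K (Suc n))" "is_union K U"
      "\<And>n. port_graph (K n)" "\<And>n. p \<in> verts (K n)"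
  shows "nondecreasing_union (\<lambda>n. modulo (K n) p) = modulo U p"
proof -
  have pU: "port_graph U" using union_port_graph[OF K] .
  have "(H, q) \<in> modulo U p" if Hq: "(H, q) \<in> nondecreasing_union (\<lambda>n. modulo (K n) p)" for H q
  proof -
    obtain G where G: "\<And>n. (G n, q) \<in> modulo (K n) p" "\<And>n. subgraph (G n) (G (Suc n))"
        "is_union G H"
      using Hq unfolding nondecreasing_union_def by blast
    then have G': "\<And>n. port_graph (G n)" "\<forall>n. \<exists>f. pointed_iso f (K n) p (G n) q"
      by (auto simp: modulo_iff)
    then obtain f where f: "\<And>n. pointed_iso (f n) (K n) p (G n) q" by metis
    have "port_graph H"
      using union_port_graph[OF G(2,3) G'(1)] pointed_iso_pointer[OF f K(4)] .
    then show ?thesis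
      using union_iso[OF K G(2,3) G'(1) f] by (metis modulo_iff)
  qed
  moreover have "(H, q) \<in> nondecreasing_union (\<lambda>n. modulo (K n) p)" if Hq: "(H, q) \<in> modulo U p" for H q
  proof -
    obtain f where H: "port_graph H" and f: "pointed_iso f U p H q"
      using Hq by (auto simp: modulo_iff)
    have wU: "wf_graph U" and wK: "wf_graph (K n)" for n
      using pU K(3) port_graph_wf by auto
    have sub: "subgraph (K n) U" for n using chain_union_subgraph[OF K(2)] .
    have inj: "inj_on f (verts U)" using f by (simp add: pointed_iso_def bij_betw_def)
    have injK: "inj_on f (verts (K n))" for n
      using inj_on_subset[OF inj] sub[of n] by (auto simp: subgraph_def)
    have injE: "inj_on (rename_edge f) (edges U)" using rename_edge_inj_on[OF inj wU] .
    define G where "G n = rename_graph f (K n)" for n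
    have iso: "pointed_iso f (K n) p (G n) q" for n
      using rename_graph_iso[OF wK injK[of n], of p] f by (simp add: pointed_iso_def G_def)
    have pG: "port_graph (G n)" for n
      unfolding G_def using rename_graph_port_graph[OF K(3) injK K(4)] .
    have V: "verts (G n) = f ` verts (K n)" and E: "edges (G n) = rename_edge f ` edges (K n)" for n
      by (auto simp: G_def rename_graph_def)
    have Vl: "vlabel (G n) x = Some s \<longleftrightarrow> (\<exists>v \<in> verts U. x = f v \<and> vlabel (K n) v = Some s)" for n x s
    proof
      assume a: "vlabel (G n) x = Some s"
      then have "x \<in> verts (G n)" using port_graph_wf[OF pG] by (auto simp: wf_graph_def)
      then obtain v where "v \<in> verts (K n)" "x = f v" using V by auto
      then show "\<exists>v \<in> verts U. x = f v \<and> vlabel (K n) v = Some s"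
        using a iso[of n] sub[of n] by (auto simp: pointed_iso_def subgraph_def)
    next
      assume "\<exists>v \<in> verts U. x = f v \<and> vlabel (K n) v = Some s"
      then obtain v where v: "x = f v" "vlabel (K n) v = Some s" by blast
      then have "v \<in> verts (K n)" using wK[of n] by (auto simp: wf_graph_def)
      then show "vlabel (G n) x = Some s" using v iso[of n] by (auto simp: pointed_iso_def)
    qed
    have El: "elabel (G n) x = Some s \<longleftrightarrow> (\<exists>e \<in> edges U. x = rename_edge f e \<and> elabel (K n) e = Some s)"
      for n x s
    proof
      assume a: "elabel (G n) x = Some s"
      then have "x \<in> edges (G n)" using port_graph_wf[OF pG[of n]] by (auto simp: wf_graph_def)
      then obtain v where "v \<in> edges (K n)" "x = rename_edge f v" using E by auto
      then show "\<exists>e \<in> edges U. x = rename_edge f e \<and> elabel (K n) e = Some s"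
        using a iso[of n] sub[of n] by (auto simp: pointed_iso_def subgraph_def)
    next
      assume "\<exists>e \<in> edges U. x = rename_edge f e \<and> elabel (K n) e = Some s"
      then obtain v where v: "x = rename_edge f v" "elabel (K n) v = Some s" by blast
      then have "v \<in> edges (K n)" using wK[of n] by (auto simp: wf_graph_def)
      then show "elabel (G n) x = Some s" using v iso[of n] by (auto simp: pointed_iso_def)
    qed
    have "subgraph (G n) (G (Suc n))" for n
    proof -
      have "vlabel (G n) \<subseteq>\<^sub>m vlabel (G (Suc n))"
        unfolding map_le_def
      proof
        fix x assume "x \<in> dom (vlabel (G n))"
        then obtain s where "vlabel (G n) x = Some s" by blast
        moreover from this have "vlabel (G (Suc n)) x = Some s"
          unfolding Vl using subgraph_vlabel[OF K(1)] by blast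
        ultimately show "vlabel (G n) x = vlabel (G (Suc n)) x" by simp
      qed
      moreover have "elabel (G n) \<subseteq>\<^sub>m elabel (G (Suc n))"
        unfolding map_le_def
      proof
        fix x assume "x \<in> dom (elabel (G n))"
        then obtain s where "elabel (G n) x = Some s" by blast
        moreover from this have "elabel (G (Suc n)) x = Some s"
          unfolding El using subgraph_elabel[OF K(1)] by blast
        ultimately show "elabel (G n) x = elabel (G (Suc n)) x" by simp
      qed
      ultimately show ?thesis using K(1)[of n] unfolding subgraph_def V E by blast
    qed
    moreover have "is_union G H"
    proof (rule is_unionI)
      have VU: "verts U = (\<Union>n. verts (K n))" "edges U = (\<Union>n. edges (K n))"
        using K(2) by (auto simp: is_union_def)
      have HV: "verts H = f ` verts U" "edges H = rename_edge f ` edges U"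
        using f by (auto simp: pointed_iso_def bij_betw_def)
      show "verts H = (\<Union>n. verts (G n))" "edges H = (\<Union>n. edges (G n))"
        unfolding V E HV VU by (auto simp: image_UN)
      show "vlabel H x = Some s \<longleftrightarrow> (\<exists>n. vlabel (G n) x = Some s)" for x s
      proof -
        have "x \<in> f ` verts U" if "vlabel H x = Some s"
          using port_graph_wf[OF H] that HV(1) by (auto simp: wf_graph_def)
        moreover have "vlabel H (f v) = vlabel U v" if "v \<in> verts U" for v
          using f that by (auto simp: pointed_iso_def)
        moreover have "v \<in> verts U" if "vlabel U v = Some s" for v
          using wU that by (auto simp: wf_graph_def)
        ultimately have "vlabel H x = Some s \<longleftrightarrow> (\<exists>v \<in> verts U. x = f v \<and> vlabel U v = Some s)"
          by (metis imageE)
        then show ?thesis using is_union_vlabel[OF K(2)] Vl by auto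
      qed
      show "elabel H x = Some s \<longleftrightarrow> (\<exists>n. elabel (G n) x = Some s)" for x s
      proof -
        have "x \<in> rename_edge f ` edges U" if "elabel H x = Some s"
          using port_graph_wf[OF H] that HV(2) by (auto simp: wf_graph_def)
        moreover have H_U: "elabel H (rename_edge f e) = elabel U e" if "e \<in> edges U" for e
          using f that by (auto simp: pointed_iso_def)
        ultimately have "elabel H x = Some s \<longleftrightarrow> (\<exists>e \<in> edges U. x = rename_edge f e \<and> elabel U e = Some s)"
          by force
        then show ?thesis using is_union_elabel[OF K(2)] El by auto
      qed
    qed
    moreover have "(G n, q) \<in> modulo (K n) p" for n
      using pG iso by (auto simp: modulo_iff)
    ultimately show ?thesis unfolding nondecreasing_union_def by blast
  qed
  ultimately show ?thesis by auto
qed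

section \<open>Binary trees and attached trees\<close>

text \<open>Disjointness of distinct edges is replaced by determinism of ports, which can be checked
  on explicit descriptions of the edges.\<close>

lemma wf_graphI:
  assumes "countable (verts G)"
    and form: "\<And>e. e \<in> edges G \<Longrightarrow>
      \<exists>u a x b. e = {(u, a), (x, b)} \<and> (u, a) \<noteq> (x, b) \<and> u \<in> verts G \<and> x \<in> verts G"
    and det: "\<And>u a x b y c. {(u, a), (x, b)} \<in> edges G \<Longrightarrow> {(u, a), (y, c)} \<in> edges G \<Longrightarrow> x = y \<and> b = c"
    and "dom (vlabel G) \<subseteq> verts G" "dom (elabel G) \<subseteq> edges G"
  shows "wf_graph G"
proof -
  have "card e = 2 \<and> fst ` e \<subseteq> verts G" if e: "e \<in> edges G" for e
    using form[OF e] by auto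
  moreover have "e \<inter> e' = {}" if e: "e \<in> edges G" "e' \<in> edges G" "e \<noteq> e'" for e e'
  proof (rule ccontr)
    assume "e \<inter> e' \<noteq> {}"
    then obtain u a where "(u, a) \<in> e" "(u, a) \<in> e'" by auto
    with form[OF e(1)] form[OF e(2)] obtain x b y c
      where "e = {(u, a), (x, b)}" "e' = {(u, a), (y, c)}"
      by (smt (verit) empty_iff insert_commute insert_iff prod.inject)
    with det e show False by blast
  qed
  ultimately show ?thesis using assms by (simp add: wf_graph_def)
qed

lemma rename_edge_mem:
  assumes "wf_graph G"
  shows "{(u, a), (x, b)} \<in> rename_edge f ` edges G \<longleftrightarrow>
    (\<exists>u' x'. u = f u' \<and> x = f x' \<and> {(u', a), (x', b)} \<in> edges G)"
proof
  assume "{(u, a), (x, b)} \<in> rename_edge f ` edges G"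
  then obtain e where e: "e \<in> edges G" "{(u, a), (x, b)} = rename_edge f e" by blast
  obtain v c y d where "e = {(v, c), (y, d)}" using wf_edgeE[OF assms e(1)] by metis
  with e show "\<exists>u' x'. u = f u' \<and> x = f x' \<and> {(u', a), (x', b)} \<in> edges G"
    by (auto simp: doubleton_eq_iff) (metis insert_commute)+
next
  assume "\<exists>u' x'. u = f u' \<and> x = f x' \<and> {(u', a), (x', b)} \<in> edges G"
  then obtain u' x' where "u = f u'" "x = f x'" "{(u', a), (x', b)} \<in> edges G" by blast
  moreover from this have "{(u, a), (x, b)} = rename_edge f {(u', a), (x', b)}" by simp
  ultimately show "{(u, a), (x, b)} \<in> rename_edge f ` edges G" by blast
qed

section \<open>The view from a vertex to its neighbours\<close>

text \<open>The neighbours themselves are forgotten, only ports and labels remain; this makes stars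
  comparable between graphs over different vertex types.\<close>

definition star :: "('v, 'p, 's, 'd) pgraph \<Rightarrow> 'v \<Rightarrow> ('p \<times> 'p \<times> 's option \<times> 'd option) set" where
  "star G v = {(a, b, vlabel G x, elabel G {(v, a), (x, b)}) | a b x. {(v, a), (x, b)} \<in> edges G}"

text \<open>The disk keeps labels only up to distance \<open>r\<close>, and a neighbour of
  \<open>v\<close> may be at distance \<open>k + 1\<close>; hence the strict inequality.\<close>

lemma star_disk:
  assumes G: "wf_graph G" and v: "v \<in> dball G p k" and kr: "k < r"
  shows "star (disk_graph G p r) v = star G v"
proof -
  have p: "p \<in> verts G" using v walk_start[OF G] by (auto simp: dball_def)
  have 1: "x \<in> dball G p r" if "{(v, a), (x, b)} \<in> edges G" for a b x
  proof -
    have "x \<in> dball G p (Suc k)" unfolding dball_Suc[OF G p] using v that by blast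
    then show ?thesis using dball_mono[of "Suc k" r G p] kr by auto
  qed
  have 2: "v \<in> dball G p r" using v kr dball_mono[of k r G p] by auto
  have 3: "dball G p r \<subseteq> dball G p (r + 1)" by (simp add: dball_mono)
  have E: "{(v, a), (x, b)} \<in> edges (disk_graph G p r) \<longleftrightarrow> {(v, a), (x, b)} \<in> edges G" for a b x
    using 1 2 3 by auto
  have L: "vlabel (disk_graph G p r) x = vlabel G x"
    "elabel (disk_graph G p r) {(v, a), (x, b)} = elabel G {(v, a), (x, b)}"
    if "{(v, a), (x, b)} \<in> edges G" for a b x
    using 1[OF that] 2 that by (auto simp: restrict_map_def)
  have "t \<in> star (disk_graph G p r) v \<longleftrightarrow> t \<in> star G v" for t
    unfolding star_def mem_Collect_eq E by (intro iff_exI) (metis L)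
  then show ?thesis by blast
qed

lemma star_iso:
  assumes f: "pointed_iso f G p H q" and G: "wf_graph G" and v: "v \<in> verts G"
  shows "star H (f v) = star G v"
proof -
  have e: "{(f v, a), (x, b)} \<in> edges H \<longleftrightarrow> (\<exists>y. {(v, a), (y, b)} \<in> edges G \<and> x = f y)" for a b x
    using pointed_iso_full[OF f G v] embedding_edge[OF pointed_iso_embedding[OF f]]
    unfolding full_at_def by blast
  have l: "vlabel H (f y) = vlabel G y \<and> elabel H {(f v, a), (f y, b)} = elabel G {(v, a), (y, b)}"
    if "{(v, a), (y, b)} \<in> edges G" for a b y
  proof -
    have "elabel H (rename_edge f {(v, a), (y, b)}) = elabel G {(v, a), (y, b)}"
      using f that by (simp only: pointed_iso_def)
    then show ?thesis using f edge_verts[OF G that] by (simp add: pointed_iso_def)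
  qed
  show ?thesis unfolding star_def e using l by force
qed

text \<open>The parameter \<open>elab\<close> only fixes the type of the edge labels.\<close>

locale tree_ports =
  fixes mk :: 's and m l r :: 'p and elab :: "'d itself"
  assumes ports: "m \<noteq> l" "m \<noteq> r" "l \<noteq> r"
begin

abbreviation T :: "('p list, 'p, 's, 'd) pgraph" where "T \<equiv> tree_graph mk m l r"
abbreviation W :: "'p list set" where "W \<equiv> lists {l, r}"
abbreviation att :: "('v, 'p, 's, 'd) pgraph \<Rightarrow> ('v + 'v \<times> 'p list, 'p, 's, 'd) pgraph" where
  "att \<equiv> attach_trees mk m l r"

abbreviation descent :: "'p list \<Rightarrow> ('p \<times> 'p) list" where "descent \<equiv> map (\<lambda>c. (c, m))"

lemma T_simps [simp]:
  "verts T = W"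
  "vlabel T x = (if x \<in> W then Some mk else None)"
  "elabel T = Map.empty"
  by (simp_all add: tree_graph_def)

section \<open>The infinite binary tree\<close>

lemma T_edge:
  "{(u, a), (x, b)} \<in> edges T \<longleftrightarrow>
     u \<in> W \<and> a \<in> {l, r} \<and> b = m \<and> x = u @ [a] \<or> x \<in> W \<and> b \<in> {l, r} \<and> a = m \<and> u = x @ [b]"
  unfolding tree_graph_def by (auto simp: doubleton_eq_iff)

lemma T_wf: "wf_graph T"
proof (rule wf_graphI)
  show "countable (verts T)" by simp
  show "x = y \<and> b = c"
    if "{(u, a), (x, b)} \<in> edges T"
      "{(u, a), (y, c)} \<in> edges T" for u a x b y c
    using that ports unfolding T_edge by auto
  show "\<exists>u a x b. e = {(u, a), (x, b)} \<and> (u, a) \<noteq> (x, b) \<and>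
      u \<in> verts T \<and> x \<in> verts T"
    if e: "e \<in> edges T" for e
  proof -
    obtain x c where "e = {(x, c), (x @ [c], m)}" "x \<in> W" "c \<in> {l, r}"
      using e unfolding tree_graph_def by auto
    then have "e = {(x, c), (x @ [c], m)} \<and> (x, c) \<noteq> (x @ [c], m) \<and>
        x \<in> verts T \<and>
        x @ [c] \<in> verts T" by simp
    then show ?thesis by blast
  qed
qed (auto split: if_splits)

lemma T_walk: "y \<in> W \<Longrightarrow> x \<in> W \<Longrightarrow> walk T y (descent x) (y @ x)"
proof (induction x arbitrary: y)
  case (Cons c x)
  then have "{(y, c), (y @ [c], m)} \<in> edges T" unfolding T_edge by auto
  then show ?case using Cons.IH[of "y @ [c]"] Cons.prems by auto
qed simp

lemma T_port_graph: "port_graph T"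
proof (rule port_graphI[OF T_wf])
  show "\<exists>w. walk T [] w v" if "v \<in> verts T" for v
    using T_walk[of "[]" v] that by auto
qed

text \<open>An edge changes the depth by one, so a ball around \<open>z\<close> whose radius is
  below the depth of \<open>z\<close> misses the root.\<close>

lemma T_dball_length:
  assumes "x \<in> dball T z k"
  shows "length z \<le> length x + k"
proof -
  have "walk T z w x \<Longrightarrow> length z \<le> length x + length w" for w
  proof (induction w arbitrary: z)
    case (Cons ab w)
    obtain a b where "ab = (a, b)" by force
    then obtain y where y: "{(z, a), (y, b)} \<in> edges T" "walk T y w x" using Cons.prems by auto
    have "length z \<le> Suc (length y)" using y(1) unfolding T_edge by auto
    then show ?case using Cons.IH[OF y(2)] by simp
  qed auto
  then show ?thesis using assms unfolding dball_def by force
qed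

text \<open>Away from its root, a tree cannot be told apart from the tree it is part of.\<close>

lemma tree_disk:
  fixes G :: "('v, 'p, 's, 'd) pgraph"
  assumes G: "port_graph G" and t: "embedding t T G"
    and full: "\<And>x. x \<in> W \<Longrightarrow> x \<noteq> [] \<Longrightarrow> full_at t T G x"
    and z: "z \<in> W" "Suc k < length z"
  shows "modulo (disk_graph G (t z) k) (t z) = modulo (disk_graph T z k) z"
proof -
  have "pointed_iso t (disk_graph T z k) z (disk_graph G (t z) k) (t z)"
  proof (rule disk_full[OF T_wf port_graph_wf[OF G] t])
    fix x assume x: "x \<in> dball T z (k + 1)"
    \<comment> \<open>The disk of radius \<open>k\<close> has vertices up to distance
      \<open>k + 1\<close>, which is why \<open>z\<close> has to be deeper than
      \<open>k + 1\<close>.\<close>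
    have "x \<noteq> []" using T_dball_length[OF x] z by auto
    moreover have "x \<in> W" using x dball_verts[of T z "k + 1"] by auto
    ultimately show "full_at t T G x" using full by blast
  qed (use z in simp)
  then show ?thesis
    using modulo_eqI disk_graph_wf[OF T_wf] self_in_dball[of z T "k + 1"] z(1) by fastforce
qed

section \<open>Graphs with a tree attached to every vertex\<close>

lemma att_simps [simp]:
  "verts (att G) = Inl ` verts G \<union> Inr ` (verts G \<times> W)"
  "vlabel (att G) (Inl v) = vlabel G v"
  "vlabel (att G) (Inr (v, x)) = (if v \<in> verts G \<and> x \<in> W then Some mk else None)"
  by (auto simp: attach_trees_def Let_def)

lemma att_edges:
  "edges (att G) = rename_edge Inl ` edges G
     \<union> (\<Union>v \<in> verts G. rename_edge (\<lambda>x. Inr (v, x)) ` edges T)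
     \<union> {{(Inl v, m), (Inr (v, []), m)} | v. v \<in> verts G}"
  unfolding attach_trees_def Let_def by simp

lemma att_edge:
  fixes G :: "('v, 'p, 's, 'd) pgraph"
  assumes G: "wf_graph G"
  shows "{(u, a), (x, b)} \<in> edges (att G) \<longleftrightarrow>
     (\<exists>u' x'. u = Inl u' \<and> x = Inl x' \<and> {(u', a), (x', b)} \<in> edges G) \<or>
     (\<exists>v \<in> verts G. \<exists>y y'. u = Inr (v, y) \<and> x = Inr (v, y') \<and>
        {(y, a), (y', b)} \<in> edges T) \<or>
     a = m \<and> b = m \<and> (\<exists>v \<in> verts G. u = Inl v \<and> x = Inr (v, []) \<or> u = Inr (v, []) \<and> x = Inl v)"
  unfolding att_edges
  by (auto simp: rename_edge_mem[OF G] rename_edge_mem[OF T_wf] doubleton_eq_iff)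

text \<open>\<open>attach_trees\<close> looks up the label at the inverse image of the edge under
  \<open>Inl\<close>; injectivity makes this the original edge.\<close>

lemma att_elabel_base:
  fixes G :: "('v, 'p, 's, 'd) pgraph"
  assumes "e \<in> edges G"
  shows "elabel (att G) (rename_edge Inl e) = elabel G e"
proof -
  have "inj (map_prod Inl id :: 'v \<times> 'p \<Rightarrow> ('v + 'v \<times> 'p list) \<times> 'p)" by (auto simp: inj_def)
  from inj_vimage_image_eq[OF this, of e] show ?thesis
    using assms by (simp add: attach_trees_def Let_def)
qed

lemma att_elabel_tree:
  assumes "(Inr z, a) \<in> e"
  shows "elabel (att G) e = None"
  using assms by (auto simp: attach_trees_def Let_def restrict_map_def)

lemma att_edge_Inl:
  fixes G :: "('v, 'p, 's, 'd) pgraph"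
  assumes G: "wf_graph G"
  shows "{(Inl v, a), (x, b)} \<in> edges (att G) \<longleftrightarrow>
     (\<exists>x'. x = Inl x' \<and> {(v, a), (x', b)} \<in> edges G) \<or>
     v \<in> verts G \<and> a = m \<and> b = m \<and> x = Inr (v, [])"
  unfolding att_edge[OF G] by auto

lemma att_edge_Inr:
  fixes G :: "('v, 'p, 's, 'd) pgraph"
  assumes G: "wf_graph G"
  shows "{(Inr (v, y), a), (x, b)} \<in> edges (att G) \<longleftrightarrow>
     v \<in> verts G \<and> ((\<exists>y'. x = Inr (v, y') \<and> {(y, a), (y', b)} \<in> edges T) \<or>
       y = [] \<and> a = m \<and> b = m \<and> x = Inl v)"
  unfolding att_edge[OF G] by auto

text \<open>The port \<open>m\<close> of every vertex must be free, so that the link to its tree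
  meets no other edge there. Alphabets are left out, since attaching trees depends only on
  this.\<close>

definition avoids :: "('v, 'p, 's, 'd) pgraph \<Rightarrow> bool" where
  "avoids G \<longleftrightarrow> port_graph G \<and> (\<forall>e \<in> edges G. m \<notin> snd ` e)"

lemma avoids_edge: "avoids G \<Longrightarrow> {(u, a), (x, b)} \<in> edges G \<Longrightarrow> a \<noteq> m \<and> b \<noteq> m"
  unfolding avoids_def by fastforce

lemma att_wf:
  fixes G :: "('v, 'p, 's, 'd) pgraph"
  assumes "avoids G"
  shows "wf_graph (att G)"
proof (rule wf_graphI)
  have G: "wf_graph G" using assms port_graph_wf by (auto simp: avoids_def)
  show "countable (verts (att G))" using G by (simp add: wf_graph_def)
  show "dom (vlabel (att G)) \<subseteq> verts (att G)"
  proof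
    fix z assume "z \<in> dom (vlabel (att G))"
    then show "z \<in> verts (att G)"
      using G by (cases z) (force simp: wf_graph_def split: if_splits)+
  qed
  show "dom (elabel (att G)) \<subseteq> edges (att G)"
    by (auto simp: attach_trees_def Let_def restrict_map_def split: if_splits)
  show "\<exists>u a x b. e = {(u, a), (x, b)} \<and> (u, a) \<noteq> (x, b) \<and> u \<in> verts (att G) \<and> x \<in> verts (att G)"
    if e: "e \<in> edges (att G)" for e
  proof -
    consider d where "d \<in> edges G" "e = rename_edge Inl d"
      | v d where "v \<in> verts G" "d \<in> edges T"
          "e = rename_edge (\<lambda>x. Inr (v, x)) d"
      | v where "v \<in> verts G" "e = {(Inl v, m), (Inr (v, []), m)}"
      using e unfolding att_edges by blast
    then show ?thesis
    proof cases
      case 1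
      obtain u a x b where "d = {(u, a), (x, b)}" "(u, a) \<noteq> (x, b)" "u \<in> verts G" "x \<in> verts G"
        using wf_edgeE[OF G 1(1)] by metis
      then have "e = {(Inl u, a), (Inl x, b)} \<and> (Inl u, a) \<noteq> (Inl x, b) \<and>
          Inl u \<in> verts (att G) \<and> Inl x \<in> verts (att G)" using 1 by simp
      then show ?thesis by blast
    next
      case 2
      obtain u a x b where "d = {(u, a), (x, b)}" "(u, a) \<noteq> (x, b)" "u \<in> W" "x \<in> W"
        using wf_edgeE[OF T_wf 2(2)] unfolding T_simps by metis
      then have "e = {(Inr (v, u), a), (Inr (v, x), b)} \<and> (Inr (v, u), a) \<noteq> (Inr (v, x), b) \<and>
          Inr (v, u) \<in> verts (att G) \<and> Inr (v, x) \<in> verts (att G)" using 2 by simp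
      then show ?thesis by blast
    next
      case 3
      then have "e = {(Inl v, m), (Inr (v, []), m)} \<and> (Inl v, m) \<noteq> (Inr (v, []), m) \<and>
          Inl v \<in> verts (att G) \<and> Inr (v, []) \<in> verts (att G)" by simp
      then show ?thesis by blast
    qed
  qed
  show "x = y \<and> b = c"
    if "{(u, a), (x, b)} \<in> edges (att G)" "{(u, a), (y, c)} \<in> edges (att G)" for u a x b y c
  proof (cases u)
    case (Inl v)
    with that show ?thesis
      using edge_det[OF G, of v a] avoids_edge[OF assms, of v a]
      by (auto simp: att_edge_Inl[OF G]) blast+
  next
    case (Inr z)
    obtain v w where z: "z = (v, w)" by force
    \<comment> \<open>Inside its tree a root has nothing at port \<open>m\<close>, so the link to
      the base vertex is its only edge there.\<close>
    have "{([], m), (y', d)} \<notin> edges T" for y' d unfolding T_edge using ports by auto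
    with that Inr z show ?thesis
      using edge_det[OF T_wf, of w a] by (auto simp: att_edge_Inr[OF G])
  qed
qed

lemma att_embedding_base:
  assumes "avoids G"
  shows "embedding Inl G (att G)"
proof -
  have "rename_edge Inl e \<in> edges (att G)" if "e \<in> edges G" for e
    using that unfolding attach_trees_def Let_def by auto
  then show ?thesis using att_elabel_base by (auto simp: embedding_def)
qed

lemma att_embedding_tree:
  fixes G :: "('v, 'p, 's, 'd) pgraph"
  assumes "avoids G" "v \<in> verts G"
  shows "embedding (\<lambda>x. Inr (v, x)) T (att G)"
proof -
  have "rename_edge (\<lambda>x. Inr (v, x)) e \<in> edges (att G) \<and>
      elabel (att G) (rename_edge (\<lambda>x. Inr (v, x)) e) = None"
    if e: "e \<in> edges T" for e
  proof -
    obtain u a x b where "e = {(u, a), (x, b)}" using wf_edgeE[OF T_wf e] by metis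
    then have "elabel (att G) (rename_edge (\<lambda>x. Inr (v, x)) e) = None"
      using att_elabel_tree[of "(v, u)" a "rename_edge (\<lambda>x. Inr (v, x)) e" G] by auto
    moreover have "rename_edge (\<lambda>x. Inr (v, x)) e \<in> edges (att G)"
      using e assms(2) unfolding attach_trees_def Let_def by auto
    ultimately show ?thesis by blast
  qed
  then show ?thesis using assms(2) by (auto simp: embedding_def inj_on_def)
qed

text \<open>The root is excluded because its link to the base vertex is not an edge of the
  tree.\<close>

lemma att_full_tree:
  fixes G :: "('v, 'p, 's, 'd) pgraph"
  assumes G: "avoids G" and x: "x \<noteq> []"
  shows "full_at (\<lambda>x. Inr (v, x)) T (att G) x"
proof -
  have "wf_graph G" using G port_graph_wf by (auto simp: avoids_def)
  then show ?thesis unfolding full_at_def using x by (auto simp: att_edge)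
qed

lemma att_port_graph:
  assumes G: "avoids G"
  shows "port_graph (att G)"
proof (cases "verts G = {}")
  case True
  then show ?thesis using att_wf[OF G] by (auto intro: port_graphI)
next
  case False
  then obtain p where p: "p \<in> verts G" by blast
  have pG: "port_graph G" using G by (simp add: avoids_def)
  have base: "\<exists>w. walk (att G) (Inl p) w (Inl v)" if v: "v \<in> verts G" for v
  proof -
    obtain w where "walk G p w v" using pG p v unfolding port_graph_def by blast
    then show ?thesis using embedding_walk[OF att_embedding_base[OF G]] by blast
  qed
  show ?thesis
  proof (rule port_graphI[OF att_wf[OF G]])
    fix z assume "z \<in> verts (att G)"
    then consider v where "z = Inl v" "v \<in> verts G"
      | v x where "z = Inr (v, x)" "v \<in> verts G" "x \<in> W" by auto
    then show "\<exists>w. walk (att G) (Inl p) w z"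
    proof cases
      case 1
      then show ?thesis using base by blast
    next
      case 2
      then have "walk (att G) (Inl v) [(m, m)] (Inr (v, []))"
        unfolding walk_single[OF att_wf[OF G]] att_edge[OF port_graph_wf[OF pG]] by auto
      moreover have "walk (att G) (Inr (v, [])) (descent x) z"
        using embedding_walk[OF att_embedding_tree[OF G 2(2)] T_walk[of "[]" x]] 2 by simp
      ultimately show ?thesis using base[OF 2(2)] walk_append[OF att_wf[OF G]] by metis
    qed
  qed
qed

text \<open>The renaming changes base vertices and the owners of trees and keeps the address within
  a tree. It is an embedding that is full everywhere.\<close>

lemma att_iso:
  fixes G :: "('v, 'p, 's, 'd) pgraph" and H :: "('w, 'p, 's, 'd) pgraph"
  assumes f: "pointed_iso f G p H q" and G: "avoids G" and H: "avoids H" and p: "p \<in> verts G"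
  shows "pointed_iso (map_sum f (map_prod f id)) (att G) (Inl p) (att H) (Inl q)"
proof -
  let ?F = "map_sum f (map_prod f id)"
  have wG: "wf_graph G" and wH: "wf_graph H"
    using G H port_graph_wf by (auto simp: avoids_def)
  note f_emb = pointed_iso_embedding[OF f]
  have inj: "inj_on f (verts G)" and V: "f ` verts G = verts H"
    using f by (auto simp: pointed_iso_def bij_betw_def)
  have fe: "{(?F u, a), (?F x, b)} \<in> edges (att H)" if "{(u, a), (x, b)} \<in> edges (att G)" for u a x b
    using that V embedding_edge[OF f_emb] unfolding att_edge[OF wG] att_edge[OF wH] by auto
  have "embedding ?F (att G) (att H)"
    unfolding embedding_def
  proof (intro conjI ballI)
    show "inj_on ?F (verts (att G))"
    proof (rule inj_onI)
      fix y z assume "y \<in> verts (att G)" "z \<in> verts (att G)" "?F y = ?F z"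
      then show "y = z" by (cases y; cases z) (auto dest: inj_onD[OF inj])
    qed
    show "?F ` verts (att G) \<subseteq> verts (att H)" using V[symmetric] by auto
    show "vlabel (att H) (?F v) = vlabel (att G) v" if "v \<in> verts (att G)" for v
      using that f V by (auto simp: pointed_iso_def)
    fix e assume e: "e \<in> edges (att G)"
    obtain u a x b where ed: "e = {(u, a), (x, b)}" using wf_edgeE[OF att_wf[OF G] e] by metis
    show "rename_edge ?F e \<in> edges (att H)" using fe e ed by simp
    show "elabel (att H) (rename_edge ?F e) = elabel (att G) e"
    proof (cases "e \<in> rename_edge Inl ` edges G")
      case True
      then obtain d where d: "d \<in> edges G" "e = rename_edge Inl d" by blast
      have "rename_edge ?F e = rename_edge Inl (rename_edge f d)"
        unfolding d(2) image_image by (intro image_cong) auto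
      moreover have "elabel H (rename_edge f d) = elabel G d" "rename_edge f d \<in> edges H"
        using f d by (auto simp: pointed_iso_def)
      ultimately show ?thesis using d by (simp add: att_elabel_base)
    next
      case False
      \<comment> \<open>An edge that does not come from \<open>G\<close> has an end in a tree, and
        edges at tree vertices are unlabelled on both sides.\<close>
      have "(\<exists>z. u = Inr z) \<or> (\<exists>z. x = Inr z)"
      proof (rule ccontr)
        assume "\<not> ?thesis"
        then obtain u' x' where "u = Inl u'" "x = Inl x'" by (meson sumE)
        then have "{(u', a), (x', b)} \<in> edges G" "e = rename_edge Inl {(u', a), (x', b)}"
          using e ed unfolding ed att_edge[OF wG] by auto
        then show False using False by blast
      qed
      then obtain z c where "(Inr z, c) \<in> e" using ed by auto
      moreover from this have "(Inr (map_prod f id z), c) \<in> rename_edge ?F e" by force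
      ultimately show ?thesis using att_elabel_tree by metis
    qed
  qed
  moreover have "full_at ?F (att G) (att H) z" if z: "z \<in> verts (att G)" for z
    unfolding full_at_def
  proof (intro allI impI)
    fix a y b assume e: "{(?F z, a), (y, b)} \<in> edges (att H)"
    show "\<exists>x. {(z, a), (x, b)} \<in> edges (att G) \<and> y = ?F x"
    proof (cases z)
      case (Inl v)
      then have v: "v \<in> verts G" using z by auto
      from e Inl consider x' where "y = Inl x'" "{(f v, a), (x', b)} \<in> edges H"
        | "a = m" "b = m" "y = Inr (f v, [])"
        unfolding att_edge[OF wH] by auto
      then show ?thesis
      proof cases
        case 1
        then obtain x where "{(v, a), (x, b)} \<in> edges G" "x' = f x"
          using pointed_iso_full[OF f wG v] unfolding full_at_def by blast
        then show ?thesis using Inl 1 unfolding att_edge[OF wG] by (intro exI[of _ "Inl x"]) auto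
      next
        case 2
        then show ?thesis using Inl v unfolding att_edge[OF wG]
          by (intro exI[of _ "Inr (v, [])"]) auto
      qed
    next
      case (Inr vx)
      then obtain v x where vx: "z = Inr (v, x)" "v \<in> verts G" using z by auto
      from e vx consider y' where "y = Inr (f v, y')"
          "{(x, a), (y', b)} \<in> edges T"
        | "a = m" "b = m" "x = []" "y = Inl (f v)"
        unfolding att_edge[OF wH] by auto
      then show ?thesis
      proof cases
        case 1
        then show ?thesis using vx unfolding att_edge[OF wG] by (intro exI[of _ "Inr (v, y')"]) auto
      next
        case 2
        then show ?thesis using vx unfolding att_edge[OF wG] by (intro exI[of _ "Inl v"]) auto
      qed
    qed
  qed
  moreover have "?F (Inl p) = Inl q" using f by (simp add: pointed_iso_def)
  ultimately show ?thesis
    using iso_of_full[OF att_wf[OF G] att_port_graph[OF H], of ?F "Inl p"] p by auto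
qed

lemma embed_modulo:
  assumes G: "avoids G" and p: "p \<in> verts G"
  shows "embed mk m l r (modulo G p) = modulo (att G) (Inl p)"
  unfolding embed_def
proof (rule Union_modulo)
  show pG: "port_graph G" using G by (simp add: avoids_def)
  fix f and H :: "(nat, _, _, _) pgraph" and q
  assume f: "pointed_iso f G p H q" and H: "port_graph H"
  \<comment> \<open>Avoiding \<open>m\<close> amounts to having all ports in \<open>- {m}\<close>,
    with arbitrary labels; in this form it is carried along isomorphisms by
    \<open>port_graph_over_iso\<close>.\<close>
  have "port_graph_over UNIV UNIV (- {m}) G"
    using G by (auto simp: avoids_def port_graph_over_def)
  from port_graph_over_iso[OF f this H] have "avoids H"
    by (auto simp: avoids_def port_graph_over_def)
  then show "modulo (att H) (Inl q) = modulo (att G) (Inl p)"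
    using modulo_eqI[OF att_iso[OF f G _ p] att_wf[OF G]] p by auto
qed (rule p)

lemma over_avoids: "port_graph_over \<Sigma> \<Delta> \<pi> G \<Longrightarrow> m \<notin> \<pi> \<Longrightarrow> avoids G"
  by (auto simp: avoids_def port_graph_over_def)

text \<open>The path used for re-pointing disappears: by connectedness every vertex of the attached
  graph is the end of one. From here on extended graphs are handled through one
  representative.\<close>

lemma tree_extended_iff:
  fixes \<Sigma> :: "'s set" and \<Delta> :: "'d set" and \<pi> :: "'p set"
  assumes "m \<notin> \<pi>"
  shows "Y \<in> tree_extended \<Sigma> \<Delta> \<pi> mk m l r \<longleftrightarrow>
    (\<exists>(G :: (nat, 'p, 's, 'd) pgraph) z. port_graph_over \<Sigma> \<Delta> \<pi> G \<and> z \<in> verts (att G) \<and> Y = modulo (att G) z)"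
proof
  assume "Y \<in> tree_extended \<Sigma> \<Delta> \<pi> mk m l r"
  then obtain X w where Y: "Y = repoint (embed mk m l r X) w" "X \<in> graphs_modulo \<Sigma> \<Delta> \<pi>"
      "w \<in> paths (embed mk m l r X)"
    unfolding tree_extended_def by blast
  from Y(2) obtain G :: "(nat, 'p, 's, 'd) pgraph" and p
    where G: "X = modulo G p" "port_graph_over \<Sigma> \<Delta> \<pi> G" "p \<in> verts G"
    unfolding graphs_modulo_def by blast
  note av = over_avoids[OF G(2) assms]
  have X: "embed mk m l r X = modulo (att G) (Inl p)" using embed_modulo[OF av G(3)] G(1) by simp
  then obtain z where z: "walk (att G) (Inl p) w z"
    using Y(3) paths_modulo[OF att_port_graph[OF av], of "Inl p" w] G(3) by auto
  then have "Y = modulo (att G) z" using Y(1) X repoint_modulo[OF att_port_graph[OF av] z] by simp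
  then show "\<exists>(G :: (nat, 'p, 's, 'd) pgraph) z.
      port_graph_over \<Sigma> \<Delta> \<pi> G \<and> z \<in> verts (att G) \<and> Y = modulo (att G) z"
    using G(2) walk_end[OF z] by blast
next
  assume "\<exists>(G :: (nat, 'p, 's, 'd) pgraph) z.
      port_graph_over \<Sigma> \<Delta> \<pi> G \<and> z \<in> verts (att G) \<and> Y = modulo (att G) z"
  then obtain G :: "(nat, 'p, 's, 'd) pgraph" and z
    where G: "port_graph_over \<Sigma> \<Delta> \<pi> G" "z \<in> verts (att G)" "Y = modulo (att G) z" by blast
  note av = over_avoids[OF G(1) assms]
  obtain p where p: "p \<in> verts G" using G(2) by auto
  then have "Inl p \<in> verts (att G)" by simp
  then obtain w where w: "walk (att G) (Inl p) w z"
    using att_port_graph[OF av] G(2) unfolding port_graph_def by blast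
  have X: "embed mk m l r (modulo G p) = modulo (att G) (Inl p)" using embed_modulo[OF av p] .
  have "w \<in> paths (embed mk m l r (modulo G p))"
    unfolding X using paths_modulo[OF att_port_graph[OF av], of "Inl p" w] w p by auto
  moreover have "Y = repoint (embed mk m l r (modulo G p)) w"
    unfolding X G(3) using repoint_modulo[OF att_port_graph[OF av] w] by simp
  moreover have "modulo G p \<in> graphs_modulo \<Sigma> \<Delta> \<pi>" using modulo_in_graphs_modulo[OF G(1) p] .
  ultimately show "Y \<in> tree_extended \<Sigma> \<Delta> \<pi> mk m l r" unfolding tree_extended_def by blast
qed

lemma att_over:
  assumes G: "port_graph_over \<Sigma> \<Delta> \<pi> G" and "m \<notin> \<pi>"
  shows "port_graph_over (\<Sigma> \<union> {mk}) \<Delta> (\<pi> \<union> {m, l, r}) (att G)"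
proof -
  note av = over_avoids[OF assms]
  have wG: "wf_graph G" using G port_graph_wf by (auto simp: port_graph_over_def)
  have "snd ` e \<subseteq> \<pi> \<union> {m, l, r}" if e: "e \<in> edges (att G)" for e
  proof -
    obtain u a x b where ed: "e = {(u, a), (x, b)}" using wf_edgeE[OF att_wf[OF av] e] by metis
    have "a \<in> \<pi> \<and> b \<in> \<pi>" if "{(u', a), (x', b)} \<in> edges G" for u' x'
    proof -
      have "snd ` {(u', a), (x', b)} \<subseteq> \<pi>" using G that unfolding port_graph_over_def by blast
      then show ?thesis by simp
    qed
    then show ?thesis using e unfolding ed att_edge[OF wG] T_edge by auto
  qed
  moreover have "ran (vlabel (att G)) \<subseteq> \<Sigma> \<union> {mk}"
  proof
    fix s assume "s \<in> ran (vlabel (att G))"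
    then obtain z where z: "vlabel (att G) z = Some s" by (auto simp: ran_def)
    show "s \<in> \<Sigma> \<union> {mk}"
    proof (cases z)
      case (Inl v)
      then show ?thesis using z G by (auto simp: port_graph_over_def ran_def)
    next
      case (Inr vx)
      then show ?thesis using z by (cases vx) (auto split: if_splits)
    qed
  qed
  moreover have "ran (elabel (att G)) \<subseteq> \<Delta>"
    using G by (auto simp: attach_trees_def Let_def port_graph_over_def ran_def restrict_map_def
        split: if_splits)
  ultimately show ?thesis using att_port_graph[OF av] by (simp add: port_graph_over_def)
qed

section \<open>Vertex types and descending walks in extended graphs\<close>

text \<open>The first two entries lead to the children. The entry \<open>t\<close> leads upwards:
  from a left child, from a right child, or from the root of an attached tree to its base vertex,
  whose label \<open>s\<close> may be \<open>None\<close>.\<close>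

definition tree_type :: "'s option \<Rightarrow> ('p \<times> 'p \<times> 's option \<times> 'd option) set \<Rightarrow> bool" where
  "tree_type L S \<longleftrightarrow> L = Some mk \<and>
     (\<exists>t. S = {(l, m, Some mk, None), (r, m, Some mk, None), t} \<and>
       (t = (m, l, Some mk, None) \<or> t = (m, r, Some mk, None) \<or>
        (\<exists>s. s \<noteq> Some mk \<and> t = (m, m, s, None))))"

text \<open>The label \<open>mk\<close> alone separates the two kinds of vertices, at the vertex and
  at its neighbours. Among themselves base vertices may be joined in any way through \<pi>, with any
  edge labels.\<close>

definition base_type :: "'p set \<Rightarrow> 's option \<Rightarrow> ('p \<times> 'p \<times> 's option \<times> 'd option) set \<Rightarrow> bool" where
  "base_type \<pi> L S \<longleftrightarrow> L \<noteq> Some mk \<and> (m, m, Some mk, None) \<in> S \<and>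
     (\<forall>a b s d. (a, b, s, d) \<in> S \<longrightarrow>
       (a, b, s, d) = (m, m, Some mk, None) \<or> a \<in> \<pi> \<and> b \<in> \<pi> \<and> s \<noteq> Some mk)"

lemma att_star_tree:
  fixes G :: "('v, 'p, 's, 'd) pgraph"
  assumes G: "port_graph_over \<Sigma> \<Delta> \<pi> G" and "m \<notin> \<pi>" and mk: "mk \<notin> \<Sigma>"
    and v: "v \<in> verts G" and x: "x \<in> W"
  shows "tree_type (vlabel (att G) (Inr (v, x))) (star (att G) (Inr (v, x)))"
proof -
  have wG: "wf_graph G" using G port_graph_wf by (auto simp: port_graph_over_def)
  have lab: "vlabel G v \<noteq> Some mk" using G mk by (auto simp: port_graph_over_def ran_def)
  have el: "elabel (att G) {(Inr (v, x), a), (y, b)} = None" for a y b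
    by (rule att_elabel_tree[of "(v, x)" a]) simp
  \<comment> \<open>The upward entry; the last letter of the address tells which child the vertex
    is.\<close>
  define t :: "'p \<times> 'p \<times> 's option \<times> 'd option" where
    "t = (if x = [] then (m, m, vlabel G v, None) else (m, last x, Some mk, None))"
  have "star (att G) (Inr (v, x)) = {(l, m, Some mk, None), (r, m, Some mk, None), t}"
  proof (cases x rule: rev_cases)
    case Nil
    then have "{(Inr (v, x), a), (y, b)} \<in> edges (att G) \<longleftrightarrow>
        a \<in> {l, r} \<and> b = m \<and> y = Inr (v, [a]) \<or> a = m \<and> b = m \<and> y = Inl v" for a y b
      unfolding att_edge_Inr[OF wG] T_edge using v by auto
    then show ?thesis
      unfolding star_def el t_def using Nil v ports ports[symmetric] by auto
  next
    case (snoc x' c)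
    have E: "{(Inr (v, x' @ [c]), a), (y, b)} \<in> edges (att G) \<longleftrightarrow>
        a \<in> {l, r} \<and> b = m \<and> y = Inr (v, x' @ [c, a]) \<or> a = m \<and> b = c \<and> y = Inr (v, x')" for a y b
      unfolding att_edge_Inr[OF wG] T_edge using v x snoc by auto
    have lc: "vlabel (att G) (Inr (v, x' @ [c, l])) = Some mk"
      "vlabel (att G) (Inr (v, x' @ [c, r])) = Some mk"
      "vlabel (att G) (Inr (v, x')) = Some mk" using v x snoc by auto
    have t: "t = (m, c, Some mk, None)" using snoc by (simp add: t_def)
    have "star (att G) (Inr (v, x' @ [c])) = {(a, b, vlabel (att G) y, None) | a b y.
        a \<in> {l, r} \<and> b = m \<and> y = Inr (v, x' @ [c, a]) \<or> a = m \<and> b = c \<and> y = Inr (v, x')}"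
      unfolding star_def E el[unfolded snoc] ..
    also have "\<dots> = {(l, m, Some mk, None), (r, m, Some mk, None), t}"
      unfolding t using lc ports ports[symmetric] by (auto simp del: att_simps)
    finally show ?thesis using snoc by simp
  qed
  moreover have "t = (m, l, Some mk, None) \<or> t = (m, r, Some mk, None) \<or>
        (\<exists>s. s \<noteq> Some mk \<and> t = (m, m, s, None))"
    using x lab by (cases x rule: rev_cases) (auto simp: t_def)
  ultimately show ?thesis unfolding tree_type_def using v x by auto
qed

lemma att_star_base:
  fixes G :: "('v, 'p, 's, 'd) pgraph"
  assumes G: "port_graph_over \<Sigma> \<Delta> \<pi> G" and "m \<notin> \<pi>" and mk: "mk \<notin> \<Sigma>"
    and v: "v \<in> verts G"
  shows "base_type \<pi> (vlabel (att G) (Inl v)) (star (att G) (Inl v))"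
proof -
  have wG: "wf_graph G" using G port_graph_wf by (auto simp: port_graph_over_def)
  have lab: "vlabel G x \<noteq> Some mk" for x using G mk by (auto simp: port_graph_over_def ran_def)
  have pi: "a \<in> \<pi> \<and> b \<in> \<pi>" if "{(u', a), (x', b)} \<in> edges G" for u' x' a b
  proof -
    have "snd ` {(u', a), (x', b)} \<subseteq> \<pi>" using G that unfolding port_graph_over_def by blast
    then show ?thesis by simp
  qed
  have el: "elabel (att G) {(Inl v, m), (Inr (v, []), m)} = None"
    by (rule att_elabel_tree[of "(v, [])" m]) simp
  show ?thesis
    unfolding base_type_def
  proof (intro conjI allI impI)
    show "vlabel (att G) (Inl v) \<noteq> Some mk" using lab by simp
    have "{(Inl v, m), (Inr (v, []), m)} \<in> edges (att G)" unfolding att_edge[OF wG] using v by auto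
    then show "(m, m, Some mk, None) \<in> star (att G) (Inl v)"
      unfolding star_def using el v
      by (intro CollectI exI[of _ m] exI[of _ "Inr (v, [])"]) auto
    fix a b s d assume "(a, b, s, d) \<in> star (att G) (Inl v)"
    then obtain x where x: "{(Inl v, a), (x, b)} \<in> edges (att G)" "s = vlabel (att G) x"
        "d = elabel (att G) {(Inl v, a), (x, b)}"
      unfolding star_def by auto
    then consider x' where "x = Inl x'" "{(v, a), (x', b)} \<in> edges G"
      | "a = m" "b = m" "x = Inr (v, [])"
      unfolding att_edge[OF wG] by auto
    then show "(a, b, s, d) = (m, m, Some mk, None) \<or> a \<in> \<pi> \<and> b \<in> \<pi> \<and> s \<noteq> Some mk"
    proof cases
      case 1
      then show ?thesis using pi x lab by auto
    next
      case 2
      then show ?thesis using x el v by auto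
    qed
  qed
qed

text \<open>A descending letter arrives by \<open>m\<close>, which no edge of \<open>G\<close> uses,
  and leaves by another port, which rules out the links between roots and base vertices. So a
  nonempty descent stays in one tree and appends \<open>x\<close> to the address.\<close>

lemma att_acyclic:
  assumes G: "avoids G" and w: "walk (att G) z (descent x) z" and x: "x \<in> W"
  shows "x = []"
proof -
  have wG: "wf_graph G" using G port_graph_wf by (auto simp: avoids_def)
  have "x = [] \<or> (\<exists>v y. u = Inr (v, y) \<and> z = Inr (v, y @ x))"
    if "walk (att G) u (descent x) z" "x \<in> W" for u
    using that
  proof (induction x arbitrary: u)
    case (Cons c x)
    then obtain u' where u': "{(u, c), (u', m)} \<in> edges (att G)" "walk (att G) u' (descent x) z"
      by auto
    have c: "c \<noteq> m" "c \<in> {l, r}" "x \<in> W" using Cons.prems ports by auto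
    obtain v y where vy: "u = Inr (v, y)" "u' = Inr (v, y @ [c])"
      using u'(1) c ports avoids_edge[OF G, of _ c _ m] unfolding att_edge[OF wG] T_edge by auto
    show ?case using Cons.IH[OF u'(2) c(3)] u'(2) vy by auto
  qed simp
  from this[OF w x] show ?thesis by auto
qed

end

section \<open>Limits of re-pointed trees\<close>

context tree_ports
begin

text \<open>All arrival ports are \<open>m\<close>, so the turns alone determine the path; read as a
  tree vertex, \<open>turn_word u n\<close> is where that path leads from the root.\<close>

abbreviation turn_word :: "(nat \<Rightarrow> 'p \<times> 'p) \<Rightarrow> nat \<Rightarrow> 'p list" where
  "turn_word u n \<equiv> map fst (suffix_word u n)"

lemma suffix_word_Suc: "suffix_word u (Suc n) = u n # suffix_word u n"
  by (simp add: suffix_word_def)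

lemma suffix_word_length [simp]: "length (suffix_word u n) = n"
  by (simp add: suffix_word_def)

lemma turn_word:
  assumes "u \<in> left_infinite_words m l r"
  shows "turn_word u n \<in> W" "descent (turn_word u n) = suffix_word u n"
proof -
  have u: "u i = (l, m) \<or> u i = (r, m)" for i
    using assms by (auto simp: left_infinite_words_def)
  show "turn_word u n \<in> W"
  proof (induction n)
    case (Suc n)
    then show ?case using u[of n] by (auto simp: suffix_word_Suc)
  qed (simp add: suffix_word_def)
  show "descent (turn_word u n) = suffix_word u n"
  proof (induction n)
    case (Suc n)
    then show ?case using u[of n] by (auto simp: suffix_word_Suc)
  qed (simp add: suffix_word_def)
qed

lemma rename_T:
  assumes t: "inj_on t W"
  shows "verts (rename_graph t T) = t ` W"
    "edges (rename_graph t T) = rename_edge t ` edges T"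
    "vlabel (rename_graph t T) = (\<lambda>v. if v \<in> t ` W then Some mk else None)"
    "elabel (rename_graph t T) = Map.empty"
  using inv_into_into[of _ t W] by (auto simp: rename_graph_def fun_eq_iff)

end

text \<open>\<open>t n\<close> maps the root of the tree to the \<open>n\<close>-th ancestor of the pointer.\<close>

locale tree_chain = tree_ports mk m l r elab
  for mk :: 's and m l r :: 'p and elab :: "'d itself" +
  fixes u :: "nat \<Rightarrow> 'p \<times> 'p" and t :: "nat \<Rightarrow> 'p list \<Rightarrow> 'v" and U :: "('v, 'p, 's, 'd) pgraph"
  assumes u: "u \<in> left_infinite_words m l r"
    and t_inj: "inj_on (t n) W"
    and t_step: "x \<in> W \<Longrightarrow> t (Suc n) (fst (u n) # x) = t n x"
    and U_union: "verts U = (\<Union>n. t n ` W)" "edges U = (\<Union>n. rename_edge (t n) ` edges T)"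
      "vlabel U = (\<lambda>v. if v \<in> verts U then Some mk else None)" "elabel U = Map.empty"
begin

section \<open>Increasing unions of copies of the tree\<close>

lemma u_fst: "fst (u n) \<in> {l, r}"
proof -
  have "u n = (l, m) \<or> u n = (r, m)" using u by (auto simp: left_infinite_words_def)
  then show ?thesis by auto
qed

text \<open>\<open>turn_word u (Suc n)\<close> begins with \<open>fst (u n)\<close>, and
  \<open>t_step\<close> strips such a letter; thus the pointer has the same name in every
  copy.\<close>

lemma t_pointer: "t n (turn_word u n) = t 0 []"
proof (induction n)
  case (Suc n)
  then show ?case using t_step[OF turn_word(1)[OF u], of n n] by (simp add: suffix_word_Suc)
qed (simp add: suffix_word_def)

text \<open>\<open>s\<close> consists of the turns from the ancestor \<open>k\<close> of the pointer
  down to its ancestor \<open>n\<close>.\<close>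

lemma t_lift:
  assumes "n \<le> k"
  obtains s where "s \<in> W" "\<And>x. x \<in> W \<Longrightarrow> t n x = t k (s @ x)"
proof -
  have "\<exists>s \<in> W. \<forall>x \<in> W. t n x = t k (s @ x)"
    using assms
  proof (induction rule: dec_induct)
    case base
    then show ?case by (intro bexI[of _ "[]"]) auto
  next
    case (step k)
    then obtain s where "s \<in> W" "\<forall>x \<in> W. t n x = t k (s @ x)" by blast
    then show ?case using u_fst[of k] t_step
      by (intro bexI[of _ "fst (u k) # s"]) auto
  qed
  then show thesis using that by blast
qed

lemma K_subgraph: "subgraph (rename_graph (t n) T) (rename_graph (t (Suc n)) T)"
proof -
  have V: "t n ` W \<subseteq> t (Suc n) ` W"
  proof
    fix v assume "v \<in> t n ` W"
    then obtain x where "x \<in> W" "v = t n x" by blast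
    then have "fst (u n) # x \<in> W" "v = t (Suc n) (fst (u n) # x)"
      using u_fst[of n] t_step[of x n] by simp_all
    then show "v \<in> t (Suc n) ` W" by blast
  qed
  have "rename_edge (t n) e \<in> rename_edge (t (Suc n)) ` edges T" if e: "e \<in> edges T" for e
  proof -
    obtain x a y b where xy: "e = {(x, a), (y, b)}" "x \<in> W" "y \<in> W"
      using wf_edgeE[OF T_wf e] unfolding T_simps by metis
    have "{(fst (u n) # x, a), (fst (u n) # y, b)} \<in> edges T"
      using e xy u_fst[of n] unfolding xy(1) T_edge by auto
    moreover have "rename_edge (t n) e = rename_edge (t (Suc n)) {(fst (u n) # x, a), (fst (u n) # y, b)}"
      using xy t_step by simp
    ultimately show ?thesis by blast
  qed
  then show ?thesis using V by (auto simp: subgraph_def rename_T[OF t_inj] map_le_def)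
qed

lemma K_union: "is_union (\<lambda>n. rename_graph (t n) T) U"
  by (rule is_unionI) (auto simp: U_union rename_T[OF t_inj] split: if_splits)

lemma K_port_graph: "port_graph (rename_graph (t n) T)"
  by (rule rename_graph_port_graph[OF T_port_graph, of _ "[]"]) (simp_all add: t_inj)

lemma K_pointer: "t 0 [] \<in> verts (rename_graph (t n) T)"
  unfolding rename_T[OF t_inj] using t_pointer[of n] turn_word(1)[OF u, of n] by (metis imageI)

lemma U_port_graph: "port_graph U"
  by (rule union_port_graph[OF K_subgraph K_union K_port_graph K_pointer])

text \<open>The tree re-pointed along \<open>suffix_word u n\<close> has pointer
  \<open>turn_word u n\<close>, which \<open>t n\<close> renames to \<open>t 0 []\<close>. The
  renamed trees share this pointer and form a chain with union \<open>U\<close>.\<close>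

lemma limit_tree_eq: "limit_tree mk m l r u = modulo U (t 0 [])"
proof -
  have "repoint (tree mk m l r) (suffix_word u n) = modulo (rename_graph (t n) T) (t 0 [])" for n
  proof -
    have "walk T [] (suffix_word u n) (turn_word u n)"
      using T_walk[of "[]" "turn_word u n"] turn_word[OF u, of n] by simp
    then have "repoint (tree mk m l r) (suffix_word u n) = modulo T (turn_word u n)"
      unfolding tree_def by (rule repoint_modulo[OF T_port_graph])
    also have "\<dots> = modulo (rename_graph (t n) T) (t 0 [])"
      using modulo_eqI[OF rename_graph_iso[OF T_wf, of "t n" "turn_word u n"] T_wf]
        t_inj turn_word(1)[OF u] by (simp add: t_pointer)
    finally show ?thesis .
  qed
  then show ?thesis
    unfolding limit_tree_def
    using nondecreasing_union_modulo[OF K_subgraph K_union K_port_graph K_pointer] by simp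
qed

lemma t_embedding: "embedding (t n) T U"
  using t_inj U_union by (auto simp: embedding_def)

text \<open>Seen from a later copy the vertex is \<open>s @ x\<close>. Since \<open>x\<close> is not
  empty, its parent still has the prefix \<open>s\<close>, so every edge at this vertex already lies
  in the copy \<open>n\<close>.\<close>

lemma t_full:
  assumes x: "x \<in> W" "x \<noteq> []"
  shows "full_at (t n) T U x"
  unfolding full_at_def
proof (intro allI impI)
  fix a y b assume "{(t n x, a), (y, b)} \<in> edges U"
  then obtain k where "{(t n x, a), (y, b)} \<in> edges (rename_graph (t k) T)"
    using U_union(2) rename_T(2)[OF t_inj] by auto
  moreover have "subgraph (rename_graph (t k) T) (rename_graph (t (max n k)) T)"
    using chain_subgraph[of "\<lambda>n. rename_graph (t n) T", OF K_subgraph] by simp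
  ultimately have "{(t n x, a), (y, b)} \<in> rename_edge (t (max n k)) ` edges T"
    using rename_T(2)[OF t_inj] by (auto simp: subgraph_def)
  then obtain x' y' where xy: "t n x = t (max n k) x'" "y = t (max n k) y'" "{(x', a), (y', b)} \<in> edges T"
    unfolding rename_edge_mem[OF T_wf] by blast
  obtain s where s: "s \<in> W" "\<And>x. x \<in> W \<Longrightarrow> t n x = t (max n k) (s @ x)"
    using t_lift[of n "max n k"] by auto
  have "x' \<in> W" using edge_verts(1)[OF T_wf xy(3)] by simp
  then have x': "x' = s @ x"
    using xy(1) s x(1) inj_onD[OF t_inj, of "max n k" x' "s @ x"] by auto
  obtain x0 c where x0: "x = x0 @ [c]" using x(2) by (cases x rule: rev_cases) auto
  have "a \<in> {l, r} \<and> b = m \<and> y' = s @ x @ [a] \<or> b \<in> {l, r} \<and> a = m \<and> y' = s @ x0 \<and> c = b"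
    using xy(3) unfolding T_edge x' x0 by auto
  then show "\<exists>y'. {(x, a), (y', b)} \<in> edges T \<and> y = t n y'"
  proof (elim disjE conjE)
    assume "a \<in> {l, r}" "b = m" "y' = s @ x @ [a]"
    then show ?thesis using x s(2)[of "x @ [a]"] xy(2) unfolding T_edge
      by (intro exI[of _ "x @ [a]"]) auto
  next
    assume "b \<in> {l, r}" "a = m" "y' = s @ x0" "c = b"
    then show ?thesis using x x0 s(2)[of x0] xy(2) unfolding T_edge
      by (intro exI[of _ x0]) auto
  qed
qed

lemma U_over: "port_graph_over {mk} {} {m, l, r} U"
proof -
  have "snd ` e \<subseteq> {m, l, r}" if e: "e \<in> edges U" for e
  proof -
    obtain n d where d: "d \<in> edges T" "e = rename_edge (t n) d" using e U_union(2) by auto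
    obtain x a y b where xy: "d = {(x, a), (y, b)}" using wf_edgeE[OF T_wf d(1)] by metis
    have "a \<in> {m, l, r} \<and> b \<in> {m, l, r}" using d(1) unfolding xy T_edge by auto
    then show ?thesis using d(2) xy by auto
  qed
  then show ?thesis
    using U_port_graph by (auto simp: port_graph_over_def U_union(3,4) ran_def)
qed

lemma limit_tree_in_closure:
  fixes \<Sigma> :: "'s set" and \<Delta> :: "'d set"
  assumes "m \<notin> \<pi>"
  shows "limit_tree mk m l r u \<in>
    closure_in (graphs_modulo (\<Sigma> \<union> {mk}) \<Delta> (\<pi> \<union> {m, l, r})) (tree_extended \<Sigma> \<Delta> \<pi> mk m l r)"
  unfolding closure_in_def limit_tree_eq
proof (intro CollectI conjI allI)
  have p: "t 0 [] \<in> verts U" using U_union(1) by auto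
  have "port_graph_over (\<Sigma> \<union> {mk}) \<Delta> (\<pi> \<union> {m, l, r}) U"
    using U_over by (auto simp: port_graph_over_def)
  then show "modulo U (t 0 []) \<in> graphs_modulo (\<Sigma> \<union> {mk}) \<Delta> (\<pi> \<union> {m, l, r})"
    using p by (rule modulo_in_graphs_modulo)
  fix k
  define z where "z = turn_word u (k + 2)"
  have z: "z \<in> W" "Suc k < length z" "t (k + 2) z = t 0 []"
    unfolding z_def using turn_word(1)[OF u] t_pointer by auto
  \<comment> \<open>A single isolated vertex without a label is a graph over any alphabet, even an
    empty one.\<close>
  define G :: "(nat, 'p, 's, 'd) pgraph" where
    "G = \<lparr>verts = {0}, edges = {}, vlabel = Map.empty, elabel = Map.empty\<rparr>"
  have "wf_graph G" by (simp add: G_def wf_graph_def)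
  then have "port_graph G"
  proof (rule port_graphI)
    show "\<exists>w. walk G 0 w v" if "v \<in> verts G" for v
      using that by (intro exI[of _ "[]"]) (simp add: G_def)
  qed
  then have G: "port_graph_over \<Sigma> \<Delta> \<pi> G" by (simp add: port_graph_over_def G_def)
  have v: "0 \<in> verts G" by (simp add: G_def)
  note av = over_avoids[OF G assms]
  have "disk (modulo (att G) (Inr (0, z))) k = modulo (disk_graph T z k) z"
    using disk_modulo[OF att_port_graph[OF av], of "Inr (0, z)" k] v z(1)
      tree_disk[OF att_port_graph[OF av] att_embedding_tree[OF av v] att_full_tree[OF av] z(1,2)] by simp
  also have "\<dots> = disk (modulo U (t 0 [])) k"
    using disk_modulo[OF U_port_graph p] tree_disk[OF U_port_graph t_embedding t_full z(1,2), of "k + 2"]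
      z(3) by simp
  finally have "disk (modulo (att G) (Inr (0, z))) k = disk (modulo U (t 0 [])) k" .
  moreover have "modulo (att G) (Inr (0, z)) \<in> tree_extended \<Sigma> \<Delta> \<pi> mk m l r"
    unfolding tree_extended_iff[OF assms] using G v z(1) by fastforce
  ultimately show "\<exists>Y \<in> tree_extended \<Sigma> \<Delta> \<pi> mk m l r. disk Y k = disk (modulo U (t 0 [])) k" by blast
qed

end

text \<open>
  A vertex of \<open>T\<^sub>u\<close> is reached by ascending \<open>n\<close> times from the pointer and then descending along
  \<open>x\<close>; \<open>limit_vertex\<close> cancels ascents against descents, and \<open>expand\<close> undoes this.
\<close>

fun limit_vertex :: "(nat \<Rightarrow> 'a) \<Rightarrow> nat \<Rightarrow> 'a list \<Rightarrow> nat \<times> 'a list" where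
  "limit_vertex c 0 x = (0, x)"
| "limit_vertex c (Suc n) [] = (Suc n, [])"
| "limit_vertex c (Suc n) (a # x) = (if a = c n then limit_vertex c n x else (Suc n, a # x))"

fun expand :: "(nat \<Rightarrow> 'a) \<Rightarrow> nat \<Rightarrow> nat \<times> 'a list \<Rightarrow> 'a list" where
  "expand c n (k, x) = rev (map c [k..<n]) @ x"

lemma expand_limit_vertex: "expand c n (limit_vertex c n x) = x"
proof -
  \<comment> \<open>When a cancelled letter is put back, the interval \<open>[k..<Suc n]\<close>
    must split into \<open>[k..<n]\<close> and \<open>n\<close>, which takes
    \<open>k \<le> n\<close>.\<close>
  have "fst (limit_vertex c n x) \<le> n" for n x
    by (induction c n x rule: limit_vertex.induct) auto
  then show ?thesis
  proof (induction c n x rule: limit_vertex.induct)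
    case (3 c n a x)
    obtain k y where ky: "limit_vertex c n x = (k, y)" by force
    moreover have "k \<le> n" using "3.prems"[of n x] ky by simp
    ultimately show ?case using 3 by auto
  qed auto
qed

context tree_ports
begin

text \<open>It remains to produce namings of the copies that agree where the copies overlap.
  Cancellation gives them: its last equation is \<open>t_step\<close>, and the left inverse
  \<open>expand\<close> makes each naming injective.\<close>

lemma limit_tree_in_closure:
  fixes \<Sigma> :: "'s set" and \<Delta> :: "'d set"
  assumes u: "u \<in> left_infinite_words m l r" and "m \<notin> \<pi>"
  shows "limit_tree mk m l r u \<in>
    closure_in (graphs_modulo (\<Sigma> \<union> {mk}) \<Delta> (\<pi> \<union> {m, l, r})) (tree_extended \<Sigma> \<Delta> \<pi> mk m l r)"
proof -
  define t where "t = limit_vertex (fst \<circ> u)"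
  define V where "V = (\<Union>n. t n ` W)"
  define U :: "(nat \<times> 'p list, 'p, 's, 'd) pgraph" where
    "U = \<lparr>verts = V, edges = (\<Union>n. rename_edge (t n) ` edges T),
      vlabel = (\<lambda>v. if v \<in> V then Some mk else None), elabel = Map.empty\<rparr>"
  interpret tree_chain mk m l r elab u t U
  proof
    show "inj_on (t n) W" for n
      unfolding t_def by (rule inj_on_inverseI[of _ "expand (fst \<circ> u) n"]) (rule expand_limit_vertex)
  qed (use u in \<open>auto simp: t_def U_def V_def\<close>)
  show ?thesis by (rule limit_tree_in_closure[OF assms(2)])
qed

end

section \<open>Graphs that locally look like extended graphs\<close>

text \<open>What the closure yields, freed from disks and witnesses, so that from here on a single
  graph \<open>G\<close> is studied.\<close>

locale locally_tree = tree_ports mk m l r elab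
  for mk :: 's and m l r :: 'p and elab :: "'d itself" +
  fixes \<pi> :: "'p set" and G :: "('v, 'p, 's, 'd) pgraph"
  assumes m_pi: "m \<notin> \<pi>"
    and G: "port_graph G"
    and types: "v \<in> verts G \<Longrightarrow>
      tree_type (vlabel G v) (star G v) \<or> base_type \<pi> (vlabel G v) (star G v)"
    and acyclic: "walk G v (descent x) v \<Longrightarrow> x \<in> W \<Longrightarrow> x = []"
begin

lemmas wG = port_graph_wf[OF G]

text \<open>Named by the label because the label decides which of the two types a vertex
  has.\<close>

definition M :: "'v set" where "M = {v \<in> verts G. vlabel G v = Some mk}"

lemma star_edge:
  "{(v, a), (y, b)} \<in> edges G \<Longrightarrow> (a, b, vlabel G y, elabel G {(v, a), (y, b)}) \<in> star G v"
  unfolding star_def by blast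

lemma M_type: "v \<in> M \<Longrightarrow> tree_type (vlabel G v) (star G v)"
  using types[of v] unfolding M_def base_type_def by blast

lemma base_type: "v \<in> verts G \<Longrightarrow> v \<notin> M \<Longrightarrow> base_type \<pi> (vlabel G v) (star G v)"
  using types[of v] unfolding M_def tree_type_def by blast

text \<open>An edge at \<open>v\<close> is one of the three entries of the star, and the neighbour
  label recorded there decides whether \<open>y\<close> is again a tree vertex.\<close>

lemma M_edge:
  assumes v: "v \<in> M" and e: "{(v, a), (y, b)} \<in> edges G"
  shows "elabel G {(v, a), (y, b)} = None \<and>
    (a \<in> {l, r} \<and> b = m \<and> y \<in> M \<or> a = m \<and> b \<in> {l, r} \<and> y \<in> M \<or> a = m \<and> b = m \<and> y \<notin> M)"
proof -
  have y: "y \<in> M \<longleftrightarrow> vlabel G y = Some mk"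
    using edge_verts(2)[OF wG e] by (simp add: M_def)
  obtain t where t: "star G v = {(l, m, Some mk, None), (r, m, Some mk, None), t}"
    "t = (m, l, Some mk, None) \<or> t = (m, r, Some mk, None) \<or> (\<exists>s. s \<noteq> Some mk \<and> t = (m, m, s, None))"
    using M_type[OF v] unfolding tree_type_def by blast
  show ?thesis
    using star_edge[OF e] t(2) unfolding y t(1) by (elim disjE exE conjE) auto
qed

section \<open>Descending from a tree vertex\<close>

definition child :: "'v \<Rightarrow> 'p \<Rightarrow> 'v" where
  "child v c = (THE y. {(v, c), (y, m)} \<in> edges G)"

lemma childI: "{(v, c), (y, m)} \<in> edges G \<Longrightarrow> child v c = y"
  unfolding child_def using edge_det[OF wG] by (intro the_equality) blast+

lemma child_edge:
  assumes v: "v \<in> M" and c: "c \<in> {l, r}"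
  shows "{(v, c), (child v c, m)} \<in> edges G" "child v c \<in> M"
proof -
  have "(c, m, Some mk, None) \<in> star G v" using M_type[OF v] c by (auto simp: tree_type_def)
  then obtain y where y: "{(v, c), (y, m)} \<in> edges G" by (auto simp: star_def)
  then show "{(v, c), (child v c, m)} \<in> edges G" using childI by blast
  then show "child v c \<in> M" using M_edge[OF v] c ports by blast
qed

abbreviation desc :: "'v \<Rightarrow> 'p list \<Rightarrow> 'v" where "desc \<equiv> foldl child"

lemma desc_M: "v \<in> M \<Longrightarrow> x \<in> W \<Longrightarrow> desc v x \<in> M"
  by (induction x arbitrary: v) (auto intro: child_edge)

lemma desc_edge:
  assumes "v \<in> M" "x \<in> W" "c \<in> {l, r}"
  shows "{(desc v x, c), (desc v (x @ [c]), m)} \<in> edges G"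
  using child_edge(1)[OF desc_M[OF assms(1,2)] assms(3)] by simp

lemma desc_embedding_edge:
  assumes v: "v \<in> M" and e: "{(x, a), (y, b)} \<in> edges T"
  shows "{(desc v x, a), (desc v y, b)} \<in> edges G"
  using e unfolding T_edge
proof (elim disjE conjE)
  assume "x \<in> W" "a \<in> {l, r}" "b = m" "y = x @ [a]"
  then show ?thesis using desc_edge[OF v] by blast
next
  assume "y \<in> W" "b \<in> {l, r}" "a = m" "x = y @ [b]"
  then show ?thesis using desc_edge[OF v, of y b] by (simp only: insert_commute)
qed

lemma desc_walk: "v \<in> M \<Longrightarrow> x \<in> W \<Longrightarrow> walk G v (descent x) (desc v x)"
proof (induction x arbitrary: v)
  case Nil
  then show ?case by (simp add: M_def)
next
  case (Cons c x)
  then have c: "{(v, c), (child v c, m)} \<in> edges G" "child v c \<in> M" using child_edge by auto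
  then show ?case using Cons.IH[OF c(2)] Cons.prems by auto
qed

text \<open>Downward edges are those of \<open>desc_edge\<close>, and below \<open>v\<close> the one
  edge at port \<open>m\<close> leads to the parent. Hence only the port \<open>m\<close> of
  \<open>v\<close> itself can lead out of the tree.\<close>

lemma desc_edge_cases:
  assumes v: "v \<in> M" and x: "x \<in> W" and e: "{(desc v x, a), (y, b)} \<in> edges G"
  obtains y' where "{(x, a), (y', b)} \<in> edges T" "y = desc v y'"
    | "x = []" "a = m"
proof -
  consider "a \<in> {l, r}" "b = m" | "a = m"
    using M_edge[OF desc_M[OF v x] e] by blast
  then show thesis
  proof cases
    case 1
    then have "y = desc v (x @ [a])" using edge_det[OF wG e desc_edge[OF v x]] by blast
    moreover have "{(x, a), (x @ [a], b)} \<in> edges T" using 1 x unfolding T_edge by auto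
    ultimately show ?thesis using that(1) by blast
  next
    case 2
    show ?thesis
    proof (cases x rule: rev_cases)
      case Nil
      then show ?thesis using that(2) 2 by blast
    next
      case (snoc x' c)
      then have c: "x' \<in> W" "c \<in> {l, r}" using x by auto
      then have "{(desc v x, m), (desc v x', c)} \<in> edges G"
        using desc_edge[OF v c] snoc by (simp add: insert_commute)
      then have "y = desc v x' \<and> b = c" using edge_det[OF wG e] 2 by blast
      moreover have "{(x, a), (x', c)} \<in> edges T" using 2 c snoc unfolding T_edge by auto
      ultimately show ?thesis using that(1) by blast
    qed
  qed
qed

text \<open>The port \<open>m\<close> of the common vertex lies in one edge, whose other end gives
  both the parent and the turn. The starting vertices may differ, for use with the roots of
  different attached trees.\<close>

lemma desc_snoc_eq:
  assumes "v \<in> M" "w \<in> M" "x \<in> W" "y \<in> W" "c \<in> {l, r}" "d \<in> {l, r}"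
    and eq: "desc v (x @ [c]) = desc w (y @ [d])"
  shows "desc v x = desc w y \<and> c = d"
proof -
  have "{(desc v (x @ [c]), m), (desc v x, c)} \<in> edges G"
    using desc_edge[OF assms(1,3,5)] by (simp add: insert_commute)
  moreover have "{(desc v (x @ [c]), m), (desc w y, d)} \<in> edges G"
    unfolding eq using desc_edge[OF assms(2,4,6)] by (simp add: insert_commute)
  ultimately show ?thesis using edge_det[OF wG] by blast
qed

text \<open>Equal ends have equal last turns and equal parents. Stripping these leaves a word that
  leads from \<open>v\<close> back to \<open>v\<close>, and \<open>acyclic\<close> makes it
  empty.\<close>

lemma desc_inj:
  assumes v: "v \<in> M"
  shows "inj_on (desc v) W"
proof (rule inj_onI)
  have nil: "y = []" if "y \<in> W" "desc v y = v" for y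
    using acyclic desc_walk[OF v that(1)] that by metis
  fix x y assume "x \<in> W" "y \<in> W" "desc v x = desc v y"
  then show "x = y"
  proof (induction x arbitrary: y rule: rev_induct)
    case Nil
    then show ?case using nil[of y] by simp
  next
    case (snoc c x)
    show ?case
    proof (cases y rule: rev_cases)
      case Nil
      then show ?thesis using nil[of "x @ [c]"] snoc.prems by simp
    next
      case y: (snoc y' d)
      then have "desc v x = desc v y' \<and> c = d"
        using snoc.prems by (intro desc_snoc_eq[OF v v]) auto
      then show ?thesis using snoc.IH[of y'] snoc.prems y by auto
    qed
  qed
qed

section \<open>Graphs without base vertices are limit trees\<close>

text \<open>An edge joining two ports \<open>m\<close> would end outside \<open>M\<close>, so each
  edge at port \<open>m\<close> arrives by \<open>l\<close> or \<open>r\<close> and thus leads to a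
  parent. The trees below the ancestors of \<open>p\<close> have a union closed under edges, hence
  equal to \<open>G\<close>.\<close>

lemma no_base_limit:
  assumes p: "p \<in> verts G" and no_base: "verts G \<subseteq> M"
  obtains u where "u \<in> left_infinite_words m l r" "limit_tree mk m l r u = modulo G p"
proof -
  have M: "verts G = M" using no_base by (auto simp: M_def)
  have "\<exists>yc. {(v, m), (fst yc, snd yc)} \<in> edges G \<and> snd yc \<in> {l, r}" if v: "v \<in> M" for v
  proof -
    obtain t where t: "star G v = {(l, m, Some mk, None), (r, m, Some mk, None), t}"
      "t = (m, l, Some mk, None) \<or> t = (m, r, Some mk, None) \<or> (\<exists>s. s \<noteq> Some mk \<and> t = (m, m, s, None))"
      using M_type[OF v] unfolding tree_type_def by blast
    then have "t \<in> star G v" "fst t = m" by auto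
    then obtain y c where e: "{(v, m), (y, c)} \<in> edges G" unfolding star_def by auto
    then have "y \<in> M" using edge_verts(2)[OF wG] M by blast
    then show ?thesis using M_edge[OF v e] e ports by (intro exI[of _ "(y, c)"]) auto
  qed
  then obtain par where par: "\<And>v. v \<in> M \<Longrightarrow> {(v, m), (fst (par v), snd (par v))} \<in> edges G"
      "\<And>v. v \<in> M \<Longrightarrow> snd (par v) \<in> {l, r}"
    by metis
  define anc where "anc n = ((fst \<circ> par) ^^ n) p" for n
  \<comment> \<open>The port by which the next ancestor holds \<open>anc n\<close>, completed by the
    arrival port \<open>m\<close> to a descending letter.\<close>
  define u where "u n = (snd (par (anc n)), m)" for n
  have anc: "anc n \<in> M" for n
  proof (induction n)
    case (Suc n)
    then show ?case using edge_verts(2)[OF wG par(1)[OF Suc]] M by (simp add: anc_def)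
  qed (use p M in \<open>simp add: anc_def\<close>)
  have up': "{(anc n, m), (anc (Suc n), fst (u n))} \<in> edges G" for n
    using par(1)[OF anc[of n]] by (simp add: anc_def u_def)
  have up: "{(anc (Suc n), fst (u n)), (anc n, m)} \<in> edges G" for n
    using up'[of n] by (simp only: insert_commute)
  have uw: "u \<in> left_infinite_words m l r"
    using par(2)[OF anc] by (auto simp: left_infinite_words_def u_def)
  define t where "t n = desc (anc n)" for n
  have step: "t (Suc n) (fst (u n) # x) = t n x" for n x
    using childI[OF up[of n]] by (simp add: t_def)
  have tM: "t n x \<in> M" if "x \<in> W" for n x using desc_M[OF anc that] by (simp add: t_def)
  \<comment> \<open>Each edge at a covered vertex lies within one copy: the copy \<open>n\<close>
    itself or, for the upward edge at its root, the copy \<open>Suc n\<close>. Having both ends in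
    the same copy gives the vertices and the edges of the union at once.\<close>
  have up_cases: "\<exists>k x' y'. v = t k x' \<and> y = t k y' \<and> {(x', a), (y', b)} \<in> edges T"
    if x: "x \<in> W" and v: "v = t n x" and e: "{(v, a), (y, b)} \<in> edges G" for n x v a y b
    using anc[of n] x e[unfolded v t_def]
  proof (cases rule: desc_edge_cases)
    case (1 y')
    then show ?thesis using v unfolding t_def by blast
  next
    case 2
    then have "{(anc n, m), (y, b)} \<in> edges G" using e v by (simp add: t_def)
    then have "y = anc (Suc n) \<and> b = fst (u n)"
      using edge_det[OF wG _ up'] by blast
    moreover have "{([fst (u n)], m), ([], fst (u n))} \<in> edges T"
      using uw unfolding T_edge by (auto simp: left_infinite_words_def u_def)
    moreover have "v = t (Suc n) [fst (u n)]" using v 2 step[of n "[]"] by simp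
    ultimately show ?thesis using 2
      by (intro exI[of _ "Suc n"] exI[of _ "[fst (u n)]"] exI[of _ "[]"]) (simp add: t_def)
  qed
  have V: "verts G = (\<Union>n. t n ` W)"
  proof
    show "verts G \<subseteq> (\<Union>n. t n ` W)"
    proof (rule connected_closed[OF G p])
      have "p = t 0 []" by (simp add: t_def anc_def)
      then show "p \<in> (\<Union>n. t n ` W)" by blast
      fix v a y b assume v: "v \<in> (\<Union>n. t n ` W)" and e: "{(v, a), (y, b)} \<in> edges G"
      obtain n x where "x \<in> W" "v = t n x" using v by blast
      from up_cases[OF this e] obtain k x' y' where "y = t k y'" "{(x', a), (y', b)} \<in> edges T"
        by blast
      moreover from this have "y' \<in> W" using edge_verts(2)[OF T_wf] unfolding T_simps by blast
      ultimately show "y \<in> (\<Union>n. t n ` W)" by blast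
    qed
    show "(\<Union>n. t n ` W) \<subseteq> verts G" using tM M by blast
  qed
  interpret tree_chain mk m l r elab u t G
  proof
    show "inj_on (t n) W" for n using desc_inj[OF anc] by (simp add: t_def)
    show "vlabel G = (\<lambda>v. if v \<in> verts G then Some mk else None)"
    proof
      fix v show "vlabel G v = (if v \<in> verts G then Some mk else None)"
      proof (cases "v \<in> verts G")
        case True
        then have "v \<in> M" using M by blast
        then show ?thesis by (simp add: M_def)
      next
        case False
        then show ?thesis using wG by (auto simp: wf_graph_def)
      qed
    qed
    show "elabel G = Map.empty"
    proof
      fix e show "elabel G e = None"
      proof (cases "e \<in> edges G")
        case True
        then obtain v a y b where vy: "e = {(v, a), (y, b)}" "v \<in> verts G" using wf_edgeE[OF wG] by metis
        then have "v \<in> M" using M by blast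
        then show ?thesis using M_edge[of v a y b] True vy(1) by blast
      next
        case False
        then show ?thesis using wG by (auto simp: wf_graph_def)
      qed
    qed
    show "edges G = (\<Union>n. rename_edge (t n) ` edges T)"
    proof (intro equalityI subsetI)
      fix e assume e: "e \<in> edges G"
      then obtain v a y b where vy: "e = {(v, a), (y, b)}" "v \<in> verts G" using wf_edgeE[OF wG] by metis
      obtain n x where x: "x \<in> W" "v = t n x" using vy(2) unfolding V by blast
      from up_cases[OF x e[unfolded vy(1)]]
      obtain k x' y' where "v = t k x'" "y = t k y'" "{(x', a), (y', b)} \<in> edges T" by blast
      moreover from this have "e = rename_edge (t k) {(x', a), (y', b)}" using vy by simp
      ultimately show "e \<in> (\<Union>n. rename_edge (t n) ` edges T)" by blast
    next
      fix e assume "e \<in> (\<Union>n. rename_edge (t n) ` edges T)"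
      then obtain n d where d: "d \<in> edges T" "e = rename_edge (t n) d" by blast
      obtain x a y b where "d = {(x, a), (y, b)}" using wf_edgeE[OF T_wf d(1)] by metis
      then show "e \<in> edges G" using d desc_embedding_edge[OF anc] by (simp add: t_def)
    qed
  qed (use uw step V in auto)
  have "t 0 [] = p" by (simp add: t_def anc_def)
  then show thesis using that[OF uw] limit_tree_eq by simp
qed

section \<open>Graphs with a base vertex are extended graphs\<close>

text \<open>The isomorphism \<open>f\<close> fixes the base part and sends the address
  \<open>x\<close> in the tree of \<open>v\<close> to the descent along \<open>x\<close> from the
  \<open>m\<close>-neighbour of \<open>v\<close>. The vertex \<open>z\<close> corresponding to the
  pointer may lie in a tree.\<close>

lemma base_attach:
  assumes over: "port_graph_over (\<Sigma> \<union> {mk}) \<Delta> \<pi>' G" and p: "p \<in> verts G"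
    and b0: "b0 \<in> verts G" "b0 \<notin> M"
  obtains H :: "('v, 'p, 's, 'd) pgraph" and z where "port_graph_over \<Sigma> \<Delta> \<pi> H"
    "z \<in> verts (att H)" "modulo G p = modulo (att H) z"
proof -
  define B where "B = {v. \<exists>w \<in> lists (\<pi> \<times> \<pi>). walk G b0 w v}"
  define E where "E = {e \<in> edges G. fst ` e \<subseteq> B \<and> snd ` e \<subseteq> \<pi>}"
  define H :: "('v, 'p, 's, 'd) pgraph" where
    "H = \<lparr>verts = B, edges = E, vlabel = vlabel G |` B, elabel = elabel G |` E\<rparr>"
  have H: "verts H = B" "edges H = E" "vlabel H = vlabel G |` B" "elabel H = elabel G |` E"
    by (simp_all add: H_def)
  have B_G: "B \<subseteq> verts G" unfolding B_def using walk_end by fastforce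
  have b0_B: "b0 \<in> B" unfolding B_def using b0(1) by (intro CollectI bexI[of _ "[]"]) auto
  have B_step: "x \<in> B" if e: "v \<in> B" "{(v, a), (x, b)} \<in> edges G" "a \<in> \<pi>" "b \<in> \<pi>" for v a x b
  proof -
    obtain w where w: "w \<in> lists (\<pi> \<times> \<pi>)" "walk G b0 w v" using e(1) unfolding B_def by blast
    have "walk G v [(a, b)] x" using e(2) walk_single[OF wG] by blast
    then have "walk G b0 (w @ [(a, b)]) x" using w(2) walk_append[OF wG] by blast
    then show ?thesis unfolding B_def using w(1) e by (intro CollectI bexI[of _ "w @ [(a, b)]"]) auto
  qed
  have base_edge: "a = m \<and> b = m \<and> x \<in> M \<and> elabel G {(v, a), (x, b)} = None \<or>
      a \<in> \<pi> \<and> b \<in> \<pi> \<and> x \<notin> M"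
    if "v \<in> verts G" "v \<notin> M" "{(v, a), (x, b)} \<in> edges G" for v a x b
    using base_type[OF that(1,2)] star_edge[OF that(3)] edge_verts(2)[OF wG that(3)]
    unfolding base_type_def M_def by blast
  have B_base: "v \<notin> M" if "v \<in> B" for v
  proof -
    obtain w where "w \<in> lists (\<pi> \<times> \<pi>)" "walk G b0 w v" using \<open>v \<in> B\<close> unfolding B_def by blast
    then show ?thesis using b0
    proof (induction w arbitrary: b0 rule: list.induct)
      case (Cons ab w)
      then obtain a b x where x: "a \<in> \<pi>" "{(b0, a), (x, b)} \<in> edges G" "walk G x w v" by auto
      then have "x \<notin> M" "x \<in> verts G"
        using base_edge[OF Cons.prems(3,4)] m_pi edge_verts(2)[OF wG] by blast+
      then show ?case using Cons.IH[OF _ x(3)] Cons.prems by auto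
    qed auto
  qed
  have H_edge: "{(v, a), (x, b)} \<in> edges H" if "v \<in> B" "{(v, a), (x, b)} \<in> edges G" "a \<in> \<pi>" "b \<in> \<pi>"
    for v a x b
    using that B_step[OF that] by (simp add: H E_def)
  have wH: "wf_graph H"
  proof (rule wf_subgraph[OF wG])
    show "edges H \<subseteq> edges G" "verts H \<subseteq> verts G" using B_G by (auto simp: H E_def)
  qed (auto simp: H E_def)
  have "port_graph H"
  proof (rule port_graphI[OF wH])
    fix v assume "v \<in> verts H"
    then obtain w where w: "w \<in> lists (\<pi> \<times> \<pi>)" "walk G b0 w v" unfolding H B_def by blast
    have "walk H b w v" if "b \<in> B" "walk G b w v" for b
      using w(1) that
    proof (induction w arbitrary: b rule: list.induct)
      case Nil
      then show ?case by (simp add: H)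
    next
      case (Cons cd w)
      obtain c d where cd: "cd = (c, d)" by force
      with Cons.prems obtain x where x: "{(b, c), (x, d)} \<in> edges G" "walk G x w v" by auto
      have "x \<in> B" using B_step[OF Cons.prems(2) x(1)] Cons.prems(1) cd by auto
      moreover have "{(b, c), (x, d)} \<in> edges H"
        using H_edge[OF Cons.prems(2) x(1)] Cons.prems(1) cd by auto
      ultimately show ?case using Cons.IH Cons.prems(1) x(2) cd by auto
    qed
    then show "\<exists>w. walk H b0 w v" using b0_B w(2) by blast
  qed
  moreover have "ran (vlabel H) \<subseteq> \<Sigma>"
  proof
    fix s assume "s \<in> ran (vlabel H)"
    then obtain v where v: "v \<in> B" "vlabel G v = Some s"
      by (auto simp: H ran_def restrict_map_def split: if_splits)
    then have "s \<noteq> mk" using B_base B_G by (auto simp: M_def)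
    then show "s \<in> \<Sigma>" using over v(2) by (auto simp: port_graph_over_def ran_def)
  qed
  moreover have "ran (elabel H) \<subseteq> \<Delta>"
    using over by (auto simp: H ran_def restrict_map_def port_graph_over_def split: if_splits)
  ultimately have H_over: "port_graph_over \<Sigma> \<Delta> \<pi> H"
    by (auto simp: port_graph_over_def H E_def)
  note av = over_avoids[OF H_over m_pi]
  have "\<exists>y. {(v, m), (y, m)} \<in> edges G" if "v \<in> B" for v
  proof -
    have "(m, m, Some mk, None) \<in> star G v"
      using base_type[OF _ B_base[OF that]] B_G that by (auto simp: base_type_def)
    then show ?thesis by (auto simp: star_def)
  qed
  then obtain root where root: "\<And>v. v \<in> B \<Longrightarrow> {(v, m), (root v, m)} \<in> edges G" by metis
  have root_M: "root v \<in> M" if "v \<in> B" for v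
    using base_edge[OF _ B_base[OF that] root[OF that]] B_G that m_pi by blast
  define f where "f = case_sum id (\<lambda>(v, x). desc (root v) x)"
  have f_simps: "f (Inl v) = v" "f (Inr (v, x)) = desc (root v) x" for v x
    by (simp_all add: f_def)
  \<comment> \<open>The port \<open>m\<close> of \<open>root w\<close> leads to the port
    \<open>m\<close> of \<open>w\<close>, whereas that of a proper descendant leads to the port
    \<open>c\<close> of its parent.\<close>
  have root_ne: "desc (root v) (x @ [c]) \<noteq> root w"
    if "v \<in> B" "w \<in> B" "x \<in> W" "c \<in> {l, r}" for v w x c
  proof
    assume eq: "desc (root v) (x @ [c]) = root w"
    have "{(root w, m), (desc (root v) x, c)} \<in> edges G"
      using desc_edge[OF root_M[OF that(1)] that(3,4)] eq by (simp add: insert_commute)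
    moreover have "{(root w, m), (w, m)} \<in> edges G"
      using root[OF that(2)] by (simp add: insert_commute)
    ultimately have "c = m" using edge_det[OF wG] by blast
    then show False using that(4) ports by auto
  qed
  have root_inj: "v = w" if "v \<in> B" "w \<in> B" "root v = root w" for v w
  proof -
    have "{(root v, m), (v, m)} \<in> edges G" "{(root v, m), (w, m)} \<in> edges G"
      using root[OF that(1)] root[OF that(2)] that(3) by (simp_all add: insert_commute)
    then show ?thesis using edge_det[OF wG] by blast
  qed
  \<comment> \<open>Stripping equal last turns ends at a root on at least one side;
    \<open>root_ne\<close> makes it a root on both, and \<open>root_inj\<close> identifies the base
    vertices.\<close>
  have desc_root_inj: "v = w \<and> x = y"
    if "v \<in> B" "w \<in> B" "x \<in> W" "y \<in> W" "desc (root v) x = desc (root w) y" for v w x y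
    using that(3-)
  proof (induction x arbitrary: y rule: rev_induct)
    case Nil
    then show ?case
      using root_inj[OF that(1,2)] root_ne[OF that(2,1)] by (cases y rule: rev_cases) auto
  next
    case (snoc c x)
    show ?case
    proof (cases y rule: rev_cases)
      case Nil
      then show ?thesis using snoc.prems root_ne[OF that(1,2), of x c] by auto
    next
      case y: (snoc y' d)
      then have "desc (root v) x = desc (root w) y' \<and> c = d"
        using snoc.prems root_M that(1,2) by (intro desc_snoc_eq) auto
      then show ?thesis using snoc.IH[of y'] snoc.prems y by auto
    qed
  qed
  have fM: "f (Inr (v, x)) \<in> M" if "v \<in> B" "x \<in> W" for v x
    unfolding f_simps using desc_M root_M that by blast
  have f_edge: "{(f z, a), (f y, b)} \<in> edges G" if e: "{(z, a), (y, b)} \<in> edges (att H)" for z a y b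
  proof -
    from e consider z' y' where "z = Inl z'" "y = Inl y'" "{(z', a), (y', b)} \<in> edges H"
      | v z' y' where "v \<in> B" "z = Inr (v, z')" "y = Inr (v, y')" "{(z', a), (y', b)} \<in> edges T"
      | v where "v \<in> B" "a = m" "b = m" "z = Inl v" "y = Inr (v, [])"
      | v where "v \<in> B" "a = m" "b = m" "z = Inr (v, [])" "y = Inl v"
      unfolding att_edge[OF wH] H(1) by blast
    then show ?thesis
    proof cases
      case 1
      then show ?thesis by (simp add: f_simps H E_def)
    next
      case 2
      then show ?thesis using desc_embedding_edge[OF root_M] by (simp add: f_simps)
    next
      case 3
      then show ?thesis using root by (simp add: f_simps)
    next
      case 4
      then show ?thesis using root by (simp add: f_simps insert_commute)
    qed
  qed
  have "embedding f (att H) G"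
    unfolding embedding_def
  proof (intro conjI ballI)
    show "inj_on f (verts (att H))"
    proof (rule inj_onI)
      fix y z assume yz: "y \<in> verts (att H)" "z \<in> verts (att H)" "f y = f z"
      consider v w where "y = Inl v" "z = Inl w"
        | v w x where "y = Inl v" "z = Inr (w, x)" "v \<in> B" "w \<in> B" "x \<in> W"
        | v w x where "y = Inr (w, x)" "z = Inl v" "v \<in> B" "w \<in> B" "x \<in> W"
        | v w x x' where "y = Inr (v, x)" "z = Inr (w, x')" "v \<in> B" "w \<in> B" "x \<in> W" "x' \<in> W"
        using yz(1,2) unfolding att_simps H(1) by blast
      then show "y = z"
      proof cases
        case 1
        then show ?thesis using yz(3) by (simp add: f_simps)
      next
        case 2
        then show ?thesis using yz(3) fM[of w x] B_base by (simp add: f_simps(1))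
      next
        case 3
        then show ?thesis using yz(3) fM[of w x] B_base by (simp add: f_simps(1))
      next
        case 4
        then show ?thesis using yz(3) desc_root_inj by (simp add: f_simps)
      qed
    qed
    have *: "f z \<in> verts G \<and> vlabel G (f z) = vlabel (att H) z" if "z \<in> verts (att H)" for z
    proof -
      consider v where "z = Inl v" "v \<in> B" | v x where "z = Inr (v, x)" "v \<in> B" "x \<in> W"
        using \<open>z \<in> verts (att H)\<close> unfolding att_simps H(1) by blast
      then show ?thesis
      proof cases
        case 1
        then show ?thesis using B_G by (auto simp: f_simps H)
      next
        case 2
        then show ?thesis using fM[of v x] by (auto simp: H M_def)
      qed
    qed
    show "f ` verts (att H) \<subseteq> verts G" using * by blast
    show "vlabel G (f z) = vlabel (att H) z" if "z \<in> verts (att H)" for z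
      using * that by blast
    fix e assume e: "e \<in> edges (att H)"
    obtain z a y b where ed: "e = {(z, a), (y, b)}" "z \<in> verts (att H)" "y \<in> verts (att H)"
      using wf_edgeE[OF att_wf[OF av] e] by metis
    have fe: "rename_edge f e = {(f z, a), (f y, b)}" "{(f z, a), (f y, b)} \<in> edges G"
      using f_edge e unfolding ed by simp_all
    then show "rename_edge f e \<in> edges G" by simp
    show "elabel G (rename_edge f e) = elabel (att H) e"
    proof (cases "\<exists>z' y'. z = Inl z' \<and> y = Inl y'")
      case True
      then obtain z' y' where zy: "z = Inl z'" "y = Inl y'" by blast
      then have "{(z', a), (y', b)} \<in> edges H" using e unfolding ed(1) att_edge[OF wH] by auto
      moreover have "e = rename_edge Inl {(z', a), (y', b)}" using ed zy by simp
      ultimately show ?thesis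
        using att_elabel_base[of "{(z', a), (y', b)}" H] fe(1) zy
        by (simp only: f_simps H restrict_in)
    next
      case False
      \<comment> \<open>The edge has an end in a tree; its image has an end in \<open>M\<close>,
        where \<open>M_edge\<close> says that edges are unlabelled.\<close>
      then obtain v x c where i: "(Inr (v, x), c) \<in> e" "v \<in> B" "x \<in> W"
        using ed unfolding att_simps H(1) by blast
      then have "f (Inr (v, x)) \<in> M" using fM by blast
      moreover have "z = Inr (v, x) \<or> y = Inr (v, x)" using i(1) ed(1) by auto
      ultimately have "elabel G {(f z, a), (f y, b)} = None"
        using M_edge[of "f z" a "f y" b] M_edge[of "f y" b "f z" a] fe(2)
        by (auto simp: insert_commute)
      then show ?thesis using fe(1) att_elabel_tree[OF i(1)] by simp
    qed
  qed
  moreover have "full_at f (att H) G z" if z: "z \<in> verts (att H)" for z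
    unfolding full_at_def
  proof (intro allI impI)
    fix a y b assume e: "{(f z, a), (y, b)} \<in> edges G"
    consider v where "z = Inl v" "v \<in> B" | v x where "z = Inr (v, x)" "v \<in> B" "x \<in> W"
      using z unfolding att_simps H(1) by blast
    then show "\<exists>x. {(z, a), (x, b)} \<in> edges (att H) \<and> y = f x"
    proof cases
      case 1
      then have e': "{(v, a), (y, b)} \<in> edges G" using e by (simp add: f_simps)
      from base_edge[OF _ B_base[OF 1(2)] e'] 1 B_G consider "a = m" "b = m" | "a \<in> \<pi>" "b \<in> \<pi>"
        by blast
      then show ?thesis
      proof cases
        case 1
        then have "y = root v" using edge_det[OF wG e'] root[OF \<open>v \<in> B\<close>] by blast
        moreover have "{(z, a), (Inr (v, []), b)} \<in> edges (att H)"
          unfolding \<open>z = Inl v\<close> att_edge_Inl[OF wH] H(1) using 1 \<open>v \<in> B\<close> by blast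
        ultimately show ?thesis by (intro exI[of _ "Inr (v, [])"]) (simp add: f_simps)
      next
        case 2
        then have "{(z, a), (Inl y, b)} \<in> edges (att H)"
          unfolding \<open>z = Inl v\<close> att_edge_Inl[OF wH] using H_edge[OF \<open>v \<in> B\<close> e'] by blast
        then show ?thesis by (intro exI[of _ "Inl y"]) (simp add: f_simps)
      qed
    next
      case 2
      have "{(desc (root v) x, a), (y, b)} \<in> edges G" using e 2 by (simp add: f_simps)
      with root_M[OF 2(2)] 2(3) show ?thesis
      proof (cases rule: desc_edge_cases)
        case (1 y')
        then have "{(z, a), (Inr (v, y'), b)} \<in> edges (att H)"
          unfolding 2(1) att_edge_Inr[OF wH] H(1) using 2(2) by blast
        then show ?thesis using 1 by (intro exI[of _ "Inr (v, y')"]) (simp add: f_simps)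
      next
        case nil: 2
        have "{(root v, m), (v, m)} \<in> edges G" using root[OF 2(2)] by (simp add: insert_commute)
        moreover have "{(root v, m), (y, b)} \<in> edges G" using e 2 nil by (simp add: f_simps)
        ultimately have y: "y = v \<and> b = m" using edge_det[OF wG] by blast
        then have "{(z, a), (Inl v, b)} \<in> edges (att H)"
          unfolding 2(1) att_edge_Inr[OF wH] H(1) using 2(2) nil by blast
        then show ?thesis using y by (intro exI[of _ "Inl v"]) (simp add: f_simps)
      qed
    qed
  qed
  moreover note iso_of_full[OF att_wf[OF av] G]
  \<comment> \<open>Neither the embedding nor its fullness mentions a pointer, so \<open>f\<close>
    is an isomorphism whichever vertex \<open>z\<close> is chosen as pointer.\<close>
  ultimately have iso: "pointed_iso f (att H) z G (f z)" if "z \<in> verts (att H)" for z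
    using that by blast
  have "f ` verts (att H) = verts G"
    using iso[of "Inl b0"] b0_B by (simp add: pointed_iso_def bij_betw_def H)
  then obtain z where z: "z \<in> verts (att H)" "p = f z" using p by blast
  then have "modulo G p = modulo (att H) z" using modulo_eqI[OF iso[OF z(1)] att_wf[OF av] z(1)] by simp
  then show thesis using that H_over z(1) by blast
qed

end

section \<open>From disks to the local hypotheses, and the two inclusions\<close>

context tree_ports
begin

text \<open>The radius serves two purposes: the star of a vertex at distance \<open>k\<close> is
  visible from radius \<open>k + 1\<close> on, and a walk of length at most \<open>N\<close> from
  there stays within distance \<open>k + N\<close>. The vertex \<open>z\<close> is the image of
  \<open>v\<close> under an isomorphism of disks.\<close>

lemma disk_transfer:
  assumes G: "port_graph G" "p \<in> verts G" and A: "port_graph A" "y \<in> verts A"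
    and eq: "disk (modulo G p) (k + N + 1) = disk (modulo A y) (k + N + 1)"
    and v: "v \<in> dball G p k"
  obtains z where "z \<in> verts A" "vlabel A z = vlabel G v" "star A z = star G v"
    "\<And>w. length w \<le> N \<Longrightarrow> walk G v w v \<Longrightarrow> walk A z w z"
proof -
  let ?r = "k + N + 1"
  let ?DG = "disk_graph G p ?r" and ?DA = "disk_graph A y ?r"
  have wG: "wf_graph G" and wA: "wf_graph A" using G A port_graph_wf by auto
  have "modulo ?DG p = modulo ?DA y" using eq disk_modulo[OF G] disk_modulo[OF A] by simp
  then obtain f where f: "pointed_iso f ?DG p ?DA y"
    using modulo_eqD disk_graph_port_graph[OF wG G(2)] disk_graph_wf[OF wA]
      self_in_dball[OF G(2)] self_in_dball[OF A(2)] by (metis disk_graph_simps(1))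
  have fp: "f p = y" using f by (simp add: pointed_iso_def)
  have walk: "walk A (f a) w (f b)" if "a \<in> dball G p j" "j + length w \<le> ?r + 1" "walk G a w b" for a w b j
    using walk_of_disk[OF embedding_walk[OF pointed_iso_embedding[OF f] walk_in_disk[OF wG that]]] .
  obtain w0 where w0: "length w0 \<le> k" "walk G p w0 v" using v by (auto simp: dball_def)
  have "walk A y w0 (f v)" using walk[OF self_in_dball[OF G(2)], of 0 w0 v] w0 fp by simp
  then have fv: "f v \<in> dball A y k" using w0(1) by (auto simp: dball_def)
  have vr: "v \<in> dball G p ?r" "f v \<in> dball A y ?r" "v \<in> dball G p (?r + 1)"
    using v fv dball_mono[of k ?r G p] dball_mono[of k ?r A y] dball_mono[of k "?r + 1" G p] by auto
  show thesis
  proof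
    show "f v \<in> verts A" using fv dball_verts[of A y k] by blast
    have "vlabel ?DA (f v) = vlabel ?DG v" using f vr(3) by (simp add: pointed_iso_def)
    then show "vlabel A (f v) = vlabel G v" using vr by simp
    have "star ?DA (f v) = star ?DG v" using star_iso[OF f disk_graph_wf[OF wG]] vr(3) by simp
    then show "star A (f v) = star G v" using star_disk[OF wG v] star_disk[OF wA fv] by simp
    show "walk A (f v) w (f v)" if "length w \<le> N" "walk G v w v" for w
      using walk[OF v _ that(2)] that(1) by simp
  qed
qed

lemma closure_locally_tree:
  fixes G :: "(nat, 'p, 's, 'd) pgraph"
  assumes m: "m \<notin> \<pi>" and mk: "mk \<notin> \<Sigma>"
    and G: "port_graph G" "p \<in> verts G"
    and closure: "\<And>k. \<exists>Y \<in> tree_extended \<Sigma> \<Delta> \<pi> mk m l r. disk Y k = disk (modulo G p) k"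
  shows "locally_tree mk m l r \<pi> G"
proof
  have transfer: "\<exists>(H :: (nat, 'p, 's, 'd) pgraph) z. port_graph_over \<Sigma> \<Delta> \<pi> H \<and> z \<in> verts (att H) \<and>
      vlabel (att H) z = vlabel G v \<and> star (att H) z = star G v \<and>
      (\<forall>w. length w \<le> N \<longrightarrow> walk G v w v \<longrightarrow> walk (att H) z w z)"
    if v: "v \<in> verts G" for v N
  proof -
    obtain w where "walk G p w v" using G v unfolding port_graph_def by blast
    then have v: "v \<in> dball G p (length w)" by (auto simp: dball_def)
    obtain Y where Y: "Y \<in> tree_extended \<Sigma> \<Delta> \<pi> mk m l r"
        "disk Y (length w + N + 1) = disk (modulo G p) (length w + N + 1)"
      using closure by blast
    then obtain H :: "(nat, 'p, 's, 'd) pgraph" and y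
      where H: "port_graph_over \<Sigma> \<Delta> \<pi> H" "y \<in> verts (att H)" "Y = modulo (att H) y"
      unfolding tree_extended_iff[OF m] by blast
    show ?thesis
      using disk_transfer[OF G att_port_graph[OF over_avoids[OF H(1) m]] H(2) _ v, of N] Y(2) H by metis
  qed
  show "m \<notin> \<pi>" "port_graph G" by fact+
  show "tree_type (vlabel G v) (star G v) \<or> base_type \<pi> (vlabel G v) (star G v)" if v: "v \<in> verts G" for v
  proof -
    obtain H :: "(nat, 'p, 's, 'd) pgraph" and z where H: "port_graph_over \<Sigma> \<Delta> \<pi> H" "z \<in> verts (att H)"
      "vlabel (att H) z = vlabel G v" "star (att H) z = star G v"
      using transfer[OF v] by blast
    from H(2) consider x where "z = Inl x" "x \<in> verts H" | y x where "z = Inr (y, x)" "y \<in> verts H" "x \<in> W"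
      by auto
    then show ?thesis
      using att_star_base[OF H(1) m mk] att_star_tree[OF H(1) m mk] H(3,4) by cases metis+
  qed
  show "x = []" if w: "walk G v (descent x) v" and x: "x \<in> W" for v x
  proof -
    \<comment> \<open>With \<open>N\<close> equal to the length of the closed walk, the radius is
      large enough for this walk to reappear in an extended graph.\<close>
    obtain H :: "(nat, 'p, 's, 'd) pgraph" and z
      where "port_graph_over \<Sigma> \<Delta> \<pi> H" "walk (att H) z (descent x) z"
      using transfer[OF walk_end[OF w], of "length x"] w by (metis length_map order_refl)
    then show ?thesis using att_acyclic[OF over_avoids[OF _ m] _ x] by blast
  qed
qed

text \<open>At every radius \<open>Y\<close> is its own witness; what has to be checked is that it
  is a graph over the enlarged labels and ports.\<close>

lemma tree_extended_subset_closure: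
  fixes \<Sigma> :: "'s set" and \<Delta> :: "'d set"
  assumes m: "m \<notin> \<pi>"
  shows "tree_extended \<Sigma> \<Delta> \<pi> mk m l r \<subseteq>
    closure_in (graphs_modulo (\<Sigma> \<union> {mk}) \<Delta> (\<pi> \<union> {m, l, r})) (tree_extended \<Sigma> \<Delta> \<pi> mk m l r)"
proof
  fix Y assume Y: "Y \<in> tree_extended \<Sigma> \<Delta> \<pi> mk m l r"
  then obtain H :: "(nat, 'p, 's, 'd) pgraph" and y
    where H: "port_graph_over \<Sigma> \<Delta> \<pi> H" "y \<in> verts (att H)" "Y = modulo (att H) y"
    unfolding tree_extended_iff[OF m] by blast
  have "Y \<in> graphs_modulo (\<Sigma> \<union> {mk}) \<Delta> (\<pi> \<union> {m, l, r})"
    unfolding H(3) using modulo_in_graphs_modulo[OF att_over[OF H(1) m] H(2)] .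
  then show "Y \<in> closure_in (graphs_modulo (\<Sigma> \<union> {mk}) \<Delta> (\<pi> \<union> {m, l, r})) (tree_extended \<Sigma> \<Delta> \<pi> mk m l r)"
    using Y unfolding closure_in_def by blast
qed

text \<open>The cases are decided by whether some vertex lacks the label \<open>mk\<close>. In the
  second one \<open>H\<close> is carved out of \<open>G\<close>, so its vertices are natural
  numbers, as \<open>tree_extended_iff\<close> asks.\<close>

lemma closure_subset:
  fixes \<Sigma> :: "'s set" and \<Delta> :: "'d set"
  assumes m: "m \<notin> \<pi>" and mk: "mk \<notin> \<Sigma>"
    and Y: "Y \<in> closure_in (graphs_modulo (\<Sigma> \<union> {mk}) \<Delta> (\<pi> \<union> {m, l, r})) (tree_extended \<Sigma> \<Delta> \<pi> mk m l r)"
  shows "Y \<in> tree_extended \<Sigma> \<Delta> \<pi> mk m l r \<union> {limit_tree mk m l r u | u. u \<in> left_infinite_words m l r}"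
proof -
  obtain G :: "(nat, 'p, 's, 'd) pgraph" and p
    where over: "port_graph_over (\<Sigma> \<union> {mk}) \<Delta> (\<pi> \<union> {m, l, r}) G" "p \<in> verts G" "Y = modulo G p"
    using Y unfolding closure_in_def graphs_modulo_def by blast
  have "port_graph G" using over(1) by (simp add: port_graph_over_def)
  then interpret locally_tree mk m l r elab \<pi> G
    using closure_locally_tree[OF m mk _ over(2)] Y unfolding closure_in_def over(3) by blast
  show ?thesis
  proof (cases "verts G \<subseteq> M")
    case True
    obtain u where "u \<in> left_infinite_words m l r" "limit_tree mk m l r u = modulo G p"
      using no_base_limit[OF over(2) True] .
    then show ?thesis using over(3) by auto
  next
    case False
    then obtain b0 where "b0 \<in> verts G" "b0 \<notin> M" by blast
    then obtain H :: "(nat, 'p, 's, 'd) pgraph" and z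
      where "port_graph_over \<Sigma> \<Delta> \<pi> H" "z \<in> verts (att H)" "modulo G p = modulo (att H) z"
      using base_attach[OF over(1,2)] by blast
    then show ?thesis unfolding over(3) Un_iff tree_extended_iff[OF m] by blast
  qed
qed

end

theorem theorem10:
  fixes \<Sigma> :: "'s set" and \<Delta> :: "'d set" and \<pi> :: "'p set"
    and mk :: 's and m l r :: 'p
  assumes "finite \<Sigma>" and "finite \<Delta>" and "finite \<pi>"
    and "mk \<notin> \<Sigma>"
    and "m \<notin> \<pi>" and "l \<notin> \<pi>" and "r \<notin> \<pi>"
    and "distinct [m, l, r]"
  shows "closure_in (graphs_modulo (\<Sigma> \<union> {mk}) \<Delta> (\<pi> \<union> {m, l, r})) (tree_extended \<Sigma> \<Delta> \<pi> mk m l r) =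
         tree_extended \<Sigma> \<Delta> \<pi> mk m l r \<union> {limit_tree mk m l r u | u. u \<in> left_infinite_words m l r}"
proof -
  interpret tree_ports mk m l r "TYPE('d)"
    using assms(8) by unfold_locales auto
  show ?thesis
  proof (intro equalityI subsetI)
    fix Y
    assume "Y \<in> closure_in (graphs_modulo (\<Sigma> \<union> {mk}) \<Delta> (\<pi> \<union> {m, l, r})) (tree_extended \<Sigma> \<Delta> \<pi> mk m l r)"
    then show "Y \<in> tree_extended \<Sigma> \<Delta> \<pi> mk m l r \<union>
        {limit_tree mk m l r u | u. u \<in> left_infinite_words m l r}"
      by (rule closure_subset[OF assms(5,4)])
  next
    fix Y
    assume "Y \<in> tree_extended \<Sigma> \<Delta> \<pi> mk m l r \<union>
        {limit_tree mk m l r u | u. u \<in> left_infinite_words m l r}"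
    then consider "Y \<in> tree_extended \<Sigma> \<Delta> \<pi> mk m l r"
      | u where "u \<in> left_infinite_words m l r" "Y = limit_tree mk m l r u" by blast
    then show "Y \<in> closure_in (graphs_modulo (\<Sigma> \<union> {mk}) \<Delta> (\<pi> \<union> {m, l, r}))
        (tree_extended \<Sigma> \<Delta> \<pi> mk m l r)"
    proof cases
      case 1
      then show ?thesis using tree_extended_subset_closure[OF assms(5)] by (rule subsetD[rotated])
    next
      case 2
      then show ?thesis using limit_tree_in_closure[OF 2(1) assms(5)] by simp
    qed
  qed
qed

end
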